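(* The neutralizing procedure $\Lambda$ is a bijection from $\mathcal{A}_{n,1}$ onto $\mathcal{N}_{n,1}=\{(N,E)\,:\,N\in\mathcal{A}_{n,1}^{0},\ E\in\mathbb{Z},\ -\ell(N)\le E\le c(N)\}$. Moreover, for $A\in\mathcal{A}_{n,1}$ with $\Lambda(A)=(N,E)$: (1) $A\in\mathcal{A}_{n,1}^{0}$ if and only if $N=A$; (2) $\Lambda(\overline{A})=(\overline{N},-E)$; (3) the opening row has the same index $k$ in $A$ and in $N$, and rows $1$ to $k$ of $A$ and $N$ coincide; in particular $r(A)=r(N)$; (4) $i(N)=i(A)$, $E=E(A)$, $B(N)=B(A)+E(A)$ and $J(N)=J(A)$.
   Context: An alternating sign matrix (ASM) of order $n$ is an $n\times n$ matrix $A=(a_{ij})$ with entries in $\{-1,0,1\}$ such that in every row and every column the nonzero entries alternate in sign, the first and the last nonzero entries being $1$. $\mathcal{A}_{n,s}$ denotes the set of order-$n$ ASMs having exactly $s$ entries equal to $-1$ (so $\mathcal{A}_{n,0}$ is the set of $n\times n$ permutation matrices). For an ASM $A=(a_{ij})$: $r(A)$ is the number of entries of the first row lying to the left of its unique nonzero entry (which is a $1$); $i(A)=\sum a_{ij}a_{k\ell}$, the sum over all pairs of positions with $k>i$ and $\ell<j$ (number of inversions); $\overline{A}=(a_{i,n+1-j})$ is the vertical reflection of $A$. Let $A\in\mathcal{A}_{n,1}$. The opening column is the column containing the unique $-1$; the closing row is the row containing the $-1$; the opening row is the row of the $1$ of the opening column lying above the $-1$. The columns strictly to the left (resp. right) of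 the opening column form the left side (resp. right side). The closing row contains exactly two $1$'s, one in each side; the one in the right side is the closing $1$ and its column is the closing column. The rows strictly between the opening row and the closing row are the enclosed rows. $A$ is neutral if there are no enclosed rows; otherwise $A$ is positive if the $1$ of the lowest enclosed row lies in the right side, and negative if it lies in the left side. $\mathcal{A}_{n,1}^{+},\mathcal{A}_{n,1}^{0},\mathcal{A}_{n,1}^{-}$ denote the sets of positive, neutral, negative elements of $\mathcal{A}_{n,1}$; $A$ is negative iff $\overline{A}$ is positive. For $A\in\mathcal{A}_{n,1}^{+}\cup\mathcal{A}_{n,1}^{0}$: the charged cell is the intersection of the enclosed rows with the right side; the extended neutral cell is the intersection of the rows from the opening row to the closing row (inclusive) with the left side. The leading $1$ is the highest $1$ in the left side strictly below the opening row; its column is the leading column; the leading cell consists of the entries strictly below the opening row and strictly between the leading column and the opening column, and $\ell(A)$ is the sum of its entries. The closing cell consists of the entries strictly below the closing row and strictly between the opening column and the closing column, and $c(A)$ is the sum of its entries; the extended closing cell consists of the entries strictly below the closing row in the columns from the opening column to the closing column inclusive. Parameters: if $A$ is positive, $E(A)$ is the sum of the entries of the charged cell; if $A$ is neutral, $E(A)=0$; if $A$ is negative, $E(A)=-E(\overline{A})$. For $A\in\mathcal{A}_{n,1}^{+}\cup\mathcal{A}_{n,1}^{0}$, $B(A)=c(A)-\ell(A)$ and $J(A)=c(A)+\ell(A)+|E(A)|+1$; for $A\in\mathcal{A}_{n,1}^{-}$, $B(A)=-B(\overline{A})$ and $J(A)=J(\overline{A})$. Horizontal displacement: for an $m\times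 q$ $(0,1)$-matrix $P$ whose nonzero columns are $j_1<\dots<j_t$ with $j_1=1$ and $j_t<q$, $H(P)$ is the $m\times q$ matrix whose column $j_{s+1}$ equals column $j_s$ of $P$ for $1\le s\le t$ (where $j_{t+1}=q$), all other columns being zero. Vertical displacement: for an $m\times q$ $(0,1)$-matrix $P$ whose nonzero rows are $i_1<\dots<i_t$ with $i_1>1$ and $i_t=m$, $V(P)$ is the $m\times q$ matrix whose row $i_{s-1}$ equals row $i_s$ of $P$ for $1\le s\le t$ (where $i_0=1$), all other rows being zero. Partial discharging procedure: for $A\in\mathcal{A}_{n,1}^{+}\cup\mathcal{A}_{n,1}^{0}$, $\delta(A)$ is obtained by applying successively the following steps (all cells, rows and columns referring to the positions they occupy in $A$): (1) replace the $-1$ and the closing $1$ by $0$; (2) replace the submatrix occupying the extended closing cell by its image under $H$; (3) replace the submatrix occupying the extended neutral cell by its image under $V$; (4) lower the entries of the extended neutral cell and of the charged cell by one row: in the left side, for each row $t$ strictly below the opening row up to and including the closing row, the left part of row $t$ becomes the former left part of row $t-1$, and the left part of the opening row becomes zero; in the right side, for each row $t$ from two rows below the opening row up to and including the closing row, the right part of row $t$ becomes the former right part of row $t-1$, and the right part of the row immediately below the opening row becomes zero. The complete discharging procedure is $\Delta(A)=(k,\delta(A),c(A),E(A))$, where $k$ is the index of the opening row of $A$. It is known that $\Delta$ is injective on $\mathcal{A}_{n,1}^{+}\cup\mathcal{A}_{n,1}^{0}$, and that whenever $\Delta(A)=(k,P,c,E)$, there is a unique $N\in\mathcal{A}_{n,1}^{+}\cup\mathcal{A}_{n,1}^{0}$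 with $\Delta(N)=(k,P,c+E,0)$, and this $N$ is neutral. Neutralizing procedure $\Lambda$: for $A\in\mathcal{A}_{n,1}^{+}\cup\mathcal{A}_{n,1}^{0}$ with $\Delta(A)=(k,P,c,E)$, $\Lambda(A)=(N,E)$ where $N$ is the unique element with $\Delta(N)=(k,P,c+E,0)$. For $A\in\mathcal{A}_{n,1}^{-}$, write $\Lambda(\overline{A})=(M,-E)$ and set $\Lambda(A)=(\overline{M},E)$. *)

theory Defs
  imports Main
begin

text \<open>An n x n matrix is a function on indices 1..n (rows, columns), zero outside.\<close>
type_synonym mat = "nat \<Rightarrow> nat \<Rightarrow> int"

definition alt_seq :: "int list \<Rightarrow> bool" where
  "alt_seq xs \<longleftrightarrow> xs \<noteq> [] \<and> hd xs = 1 \<and> last xs = 1 \<and>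
     (\<forall>k. Suc k < length xs \<longrightarrow> xs ! k * xs ! Suc k = -1)"

definition row_nz :: "nat \<Rightarrow> mat \<Rightarrow> nat \<Rightarrow> int list" where
  "row_nz n A i = filter (\<lambda>x. x \<noteq> 0) (map (\<lambda>j. A i j) [1..<Suc n])"

definition col_nz :: "nat \<Rightarrow> mat \<Rightarrow> nat \<Rightarrow> int list" where
  "col_nz n A j = filter (\<lambda>x. x \<noteq> 0) (map (\<lambda>i. A i j) [1..<Suc n])"

definition is_asm :: "nat \<Rightarrow> mat \<Rightarrow> bool" where
  "is_asm n A \<longleftrightarrow>
     (\<forall>i j. (i < 1 \<or> n < i \<or> j < 1 \<or> n < j) \<longrightarrow> A i j = 0) \<and>
     (\<forall>i j. A i j \<in> {-1, 0, 1}) \<and>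
     (\<forall>i\<in>{1..n}. alt_seq (row_nz n A i)) \<and>
     (\<forall>j\<in>{1..n}. alt_seq (col_nz n A j))"

definition asm_set :: "nat \<Rightarrow> nat \<Rightarrow> mat set" where
  "asm_set n s = {A. is_asm n A \<and> card {(i, j). A i j = -1} = s}"

definition reflect :: "nat \<Rightarrow> mat \<Rightarrow> mat" where
  "reflect n A = (\<lambda>i j. if 1 \<le> j \<and> j \<le> n then A i (Suc n - j) else 0)"

definition r_par :: "mat \<Rightarrow> nat" where
  "r_par A = (THE j. A 1 j = 1) - 1"

definition inversions :: "nat \<Rightarrow> mat \<Rightarrow> int" where
  "inversions n A = (\<Sum>i\<in>{1..n}. \<Sum>j\<in>{1..n}. \<Sum>k\<in>{1..n}. \<Sum>l\<in>{1..n}.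
      if i < k \<and> l < j then A i j * A k l else 0)"

definition minus_pos :: "mat \<Rightarrow> nat \<times> nat" where
  "minus_pos A = (THE p. A (fst p) (snd p) = -1)"

definition closing_row :: "mat \<Rightarrow> nat" where
  "closing_row A = fst (minus_pos A)"

definition opening_col :: "mat \<Rightarrow> nat" where
  "opening_col A = snd (minus_pos A)"

definition opening_row :: "mat \<Rightarrow> nat" where
  "opening_row A = (THE i. i < closing_row A \<and> A i (opening_col A) = 1)"

definition closing_col :: "mat \<Rightarrow> nat" where
  "closing_col A = (THE j. opening_col A < j \<and> A (closing_row A) j = 1)"

definition is_neutral :: "mat \<Rightarrow> bool" where
  "is_neutral A \<longleftrightarrow> closing_row A = Suc (opening_row A)"

definition lowest_enclosed_col :: "mat \<Rightarrow> nat" where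
  "lowest_enclosed_col A = (THE j. A (closing_row A - 1) j = 1)"

definition is_positive :: "mat \<Rightarrow> bool" where
  "is_positive A \<longleftrightarrow> \<not> is_neutral A \<and> opening_col A < lowest_enclosed_col A"

definition is_negative :: "mat \<Rightarrow> bool" where
  "is_negative A \<longleftrightarrow> \<not> is_neutral A \<and> lowest_enclosed_col A < opening_col A"

definition charge_cell :: "nat \<Rightarrow> mat \<Rightarrow> int" where
  "charge_cell n A = (\<Sum>i\<in>{opening_row A<..<closing_row A}. \<Sum>j\<in>{opening_col A<..n}. A i j)"

definition Echarge :: "nat \<Rightarrow> mat \<Rightarrow> int" where
  "Echarge n A = (if is_positive A then charge_cell n A
                  else if is_neutral A then 0
                  else - charge_cell n (reflect n A))"

definition leading_row :: "mat \<Rightarrow> nat" where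
  "leading_row A = (LEAST i. opening_row A < i \<and> (\<exists>j. 1 \<le> j \<and> j < opening_col A \<and> A i j = 1))"

definition leading_col :: "mat \<Rightarrow> nat" where
  "leading_col A = (THE j. 1 \<le> j \<and> j < opening_col A \<and> A (leading_row A) j = 1)"

definition ell :: "nat \<Rightarrow> mat \<Rightarrow> int" where
  "ell n A = (\<Sum>i\<in>{opening_row A<..n}. \<Sum>j\<in>{leading_col A<..<opening_col A}. A i j)"

definition cpar :: "nat \<Rightarrow> mat \<Rightarrow> int" where
  "cpar n A = (\<Sum>i\<in>{closing_row A<..n}. \<Sum>j\<in>{opening_col A<..<closing_col A}. A i j)"

definition Bpar :: "nat \<Rightarrow> mat \<Rightarrow> int" where
  "Bpar n A = (if is_negative A
     then - (cpar n (reflect n A) - ell n (reflect n A))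
     else cpar n A - ell n A)"

definition Jpar :: "nat \<Rightarrow> mat \<Rightarrow> int" where
  "Jpar n A = (if is_negative A
     then cpar n (reflect n A) + ell n (reflect n A) + \<bar>Echarge n (reflect n A)\<bar> + 1
     else cpar n A + ell n A + \<bar>Echarge n A\<bar> + 1)"

definition hdisp :: "mat \<Rightarrow> nat set \<Rightarrow> nat \<Rightarrow> nat \<Rightarrow> mat" where
  "hdisp M R a b = (let S = {j \<in> {a..b}. \<exists>i\<in>R. M i j \<noteq> 0};
                        T = (S - {Min S}) \<union> {b} in
     (\<lambda>i j. if i \<in> R \<and> a \<le> j \<and> j \<le> b
            then (if j \<in> T then M i (Max {j' \<in> S. j' < j}) else 0)
            else M i j))"

definition vdisp :: "mat \<Rightarrow> nat \<Rightarrow> nat \<Rightarrow> nat set \<Rightarrow> mat" where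
  "vdisp M a b C = (let S = {i \<in> {a..b}. \<exists>j\<in>C. M i j \<noteq> 0};
                        T = {a} \<union> (S - {Max S}) in
     (\<lambda>i j. if a \<le> i \<and> i \<le> b \<and> j \<in> C
            then (if i \<in> T then M (Min {i' \<in> S. i < i'}) j else 0)
            else M i j))"

definition delta :: "nat \<Rightarrow> mat \<Rightarrow> mat" where
  "delta n A = (let orow = opening_row A; p = closing_row A; q = opening_col A; cc = closing_col A;
     M1 = (\<lambda>i j. if i = p \<and> (j = q \<or> j = cc) then 0 else A i j);
     M2 = hdisp M1 {p<..n} q cc;
     M3 = vdisp M2 orow p {1..<q}
   in (\<lambda>i j. if 1 \<le> j \<and> j < q \<and> orow \<le> i \<and> i \<le> p
             then (if i = orow then 0 else M3 (i - 1) j)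
           else if q < j \<and> j \<le> n \<and> Suc orow \<le> i \<and> i \<le> p
             then (if i = Suc orow then 0 else M3 (i - 1) j)
           else M3 i j))"

definition Delta :: "nat \<Rightarrow> mat \<Rightarrow> nat \<times> mat \<times> int \<times> int" where
  "Delta n A = (opening_row A, delta n A, cpar n A, Echarge n A)"

definition Lam0 :: "nat \<Rightarrow> mat \<Rightarrow> mat \<times> int" where
  "Lam0 n A = ((THE N. N \<in> asm_set n 1 \<and> (is_positive N \<or> is_neutral N) \<and>
                  Delta n N = (opening_row A, delta n A, cpar n A + Echarge n A, 0)),
               Echarge n A)"

definition Lambda :: "nat \<Rightarrow> mat \<Rightarrow> mat \<times> int" where
  "Lambda n A = (if is_negative A
     then (case Lam0 n (reflect n A) of (M, E) \<Rightarrow> (reflect n M, - E))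
     else Lam0 n A)"

definition Nset :: "nat \<Rightarrow> (mat \<times> int) set" where
  "Nset n = {(N, E). N \<in> asm_set n 1 \<and> is_neutral N \<and> - ell n N \<le> E \<and> E \<le> cpar n N}"

end

theory Submission
  imports Defs
begin

text \<open>
  A matrix with exactly one entry \<open>-1\<close>, at position \<open>(p, q)\<close>, is given by the function \<open>h\<close> sending
  each row to the column of its \<open>1\<close> (the left one for row \<open>p\<close>) together with the closing column \<open>b\<close>;
  the column \<open>q\<close> is hit in rows \<open>k < p < m\<close>, and \<open>h(m := b)\<close> is a permutation. In these terms
  \<open>delta\<close> yields the matrix of a permutation \<open>f\<close>, with \<open>f k = q\<close> and \<open>f (k + 1) < q\<close>, in which
  the left entries of rows \<open>k + 1, ..., p\<close> and the columns \<open>q, ..., b\<close> below row \<open>p\<close> have been shifted by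
  one step each. The charge \<open>E\<close> is the number of entries of \<open>f\<close> to the right of column \<open>q\<close> in rows
  \<open>k + 1, ..., p\<close>, and \<open>c + 1\<close> is the number of those below row \<open>p\<close> in columns \<open>q + 1, ..., b\<close>. Hence
  \<open>E\<close> determines \<open>p\<close>, then \<open>c\<close> determines \<open>b\<close>, and every pair \<open>c, E \<ge> 0\<close> with \<open>c + E + 1\<close> at most the
  number of entries of \<open>f\<close> to the right of \<open>q\<close> and below row \<open>k\<close> occurs exactly once. Trading \<open>E\<close> for \<open>c\<close>
  is therefore always possible, and it preserves the number of inversions, which is \<open>inv f + E + c + 1\<close>. On
  a neutral matrix the reflection exchanges \<open>c\<close> and \<open>l\<close>, which gives the range of negative charges.
\<close>

section \<open>Interlacing sets and alternating sequences\<close>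

text \<open>\<open>vdisp\<close> fetches a row from the \<open>Min\<close> of the later occupied
  rows, \<open>hdisp\<close> a column from the \<open>Max\<close> of the earlier occupied columns;
  \<open>nxt\<close> and \<open>prv\<close> name these lookups.\<close>

definition nxt :: "nat set \<Rightarrow> nat \<Rightarrow> nat" where
  "nxt S x = Min {y \<in> S. x < y}"

definition prv :: "nat set \<Rightarrow> nat \<Rightarrow> nat" where
  "prv S y = Max {x \<in> S. x < y}"

text \<open>Adding the lower or the upper end to \<open>X\<close> gives two interlacing sets, and
  moving each element to the next one is a bijection between them. Both displacements are such
  shifts: of left rows between \<open>k\<close> and \<open>p\<close>, and of lower columns between
  \<open>q\<close> and \<open>b\<close>.\<close>

locale interlacing =
  fixes X :: "nat set" and lo hi :: nat
  assumes lo_hi: "lo < hi" and X_sub: "X \<subseteq> {lo<..<hi}"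
begin

lemma finite_X: "finite X"
  using X_sub finite_subset by blast

lemma nxt_props:
  assumes "x \<in> insert lo X"
  shows "nxt (insert hi X) x \<in> insert hi X" and "x < nxt (insert hi X) x"
    and "\<And>y. y \<in> insert hi X \<Longrightarrow> x < y \<Longrightarrow> nxt (insert hi X) x \<le> y"
proof -
  let ?S = "{y \<in> insert hi X. x < y}"
  have "hi \<in> ?S" using assms X_sub lo_hi by auto
  moreover have fin: "finite ?S" using finite_X by simp
  ultimately have "Min ?S \<in> ?S" using Min_in by blast
  then show "nxt (insert hi X) x \<in> insert hi X" "x < nxt (insert hi X) x"
    by (auto simp: nxt_def)
  show "nxt (insert hi X) x \<le> y" if "y \<in> insert hi X" "x < y" for y
    unfolding nxt_def using fin that by (intro Min_le) auto
qed

lemma prv_props: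
  assumes "y \<in> insert hi X"
  shows "prv (insert lo X) y \<in> insert lo X" and "prv (insert lo X) y < y"
    and "\<And>x. x \<in> insert lo X \<Longrightarrow> x < y \<Longrightarrow> x \<le> prv (insert lo X) y"
proof -
  let ?S = "{x \<in> insert lo X. x < y}"
  have "lo \<in> ?S" using assms X_sub lo_hi by auto
  moreover have fin: "finite ?S" using finite_X by simp
  ultimately have "Max ?S \<in> ?S" using Max_in by blast
  then show "prv (insert lo X) y \<in> insert lo X" "prv (insert lo X) y < y"
    by (auto simp: prv_def)
  show "x \<le> prv (insert lo X) y" if "x \<in> insert lo X" "x < y" for x
    unfolding prv_def using fin that by (intro Max_ge) auto
qed

text \<open>An element of \<open>insert lo X\<close> strictly between \<open>x\<close> and its
  successor would lie in \<open>X\<close> and be an earlier successor.\<close>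

lemma prv_nxt:
  assumes "x \<in> insert lo X" shows "prv (insert lo X) (nxt (insert hi X) x) = x"
proof -
  let ?y = "nxt (insert hi X) x"
  have y: "?y \<in> insert hi X" "x < ?y" using nxt_props[OF assms] by auto
  have "x \<le> prv (insert lo X) ?y" using prv_props(3)[OF y(1) assms y(2)] .
  moreover have "\<not> x < prv (insert lo X) ?y"
  proof
    assume a: "x < prv (insert lo X) ?y"
    then have "prv (insert lo X) ?y \<in> insert hi X"
      using prv_props(1)[OF y(1)] assms X_sub by auto
    then show False using nxt_props(3)[OF assms _ a] prv_props(2)[OF y(1)] by auto
  qed
  ultimately show ?thesis by simp
qed

lemma nxt_prv:
  assumes "y \<in> insert hi X" shows "nxt (insert hi X) (prv (insert lo X) y) = y"
proof -
  let ?x = "prv (insert lo X) y"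
  have x: "?x \<in> insert lo X" "?x < y" using prv_props[OF assms] by auto
  have "nxt (insert hi X) ?x \<le> y" using nxt_props(3)[OF x(1) assms x(2)] .
  moreover have "\<not> nxt (insert hi X) ?x < y"
  proof
    assume a: "nxt (insert hi X) ?x < y"
    then have "nxt (insert hi X) ?x \<in> insert lo X"
      using nxt_props(1)[OF x(1)] assms X_sub by auto
    then show False using prv_props(3)[OF assms _ a] nxt_props(2)[OF x(1)] by auto
  qed
  ultimately show ?thesis by simp
qed

text \<open>Translates between asking where the content of a column comes from and asking where an
  entry goes.\<close>

lemma prv_eq_iff:
  assumes "x \<in> insert lo X" "y \<in> insert hi X"
  shows "prv (insert lo X) y = x \<longleftrightarrow> y = nxt (insert hi X) x"
  using prv_nxt[OF assms(1)] nxt_prv[OF assms(2)] by metis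

lemma bij_betw_nxt: "bij_betw (nxt (insert hi X)) (insert lo X) (insert hi X)"
  using prv_nxt nxt_prv nxt_props(1) prv_props(1)
  by (intro bij_betw_byWitness[where f' = "prv (insert lo X)"] ballI image_subsetI)

lemma bij_betw_prv: "bij_betw (prv (insert lo X)) (insert hi X) (insert lo X)"
  using prv_nxt nxt_prv nxt_props(1) prv_props(1)
  by (intro bij_betw_byWitness[where f' = "nxt (insert hi X)"] ballI image_subsetI)

text \<open>If \<open>u < v\<close>, then \<open>v\<close> is itself a candidate for the successor
  of \<open>u\<close>, and it lies below its own successor. Monotonicity keeps the inversions among
  shifted entries.\<close>

lemma nxt_less_iff:
  assumes "x \<in> insert lo X" "x' \<in> insert lo X"
  shows "nxt (insert hi X) x < nxt (insert hi X) x' \<longleftrightarrow> x < x'"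
proof -
  have mono: "nxt (insert hi X) u < nxt (insert hi X) v"
    if u: "u \<in> insert lo X" and v: "v \<in> insert lo X" and "u < v" for u v
  proof -
    have "v \<in> insert hi X" using u v \<open>u < v\<close> X_sub by auto
    then have "nxt (insert hi X) u \<le> v" using nxt_props(3)[OF u] \<open>u < v\<close> by blast
    then show ?thesis using nxt_props(2)[OF v] by linarith
  qed
  show ?thesis using mono[OF assms] mono[OF assms(2,1)] by (metis less_asym linorder_neqE_nat)
qed

end

section \<open>Alternating sequences as conditions on partial sums\<close>

lemma alt_seq_Cons:
  "alt_seq (x # ys) \<longleftrightarrow> x = 1 \<and> (ys = [] \<or> (\<exists>zs. ys = -1 # zs \<and> alt_seq zs))"
proof (cases ys)
  case Nil
  then show ?thesis by (simp add: alt_seq_def)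
next
  case (Cons y zs)
  show ?thesis
  proof
    assume a: "alt_seq (x # ys)"
    have x: "x = 1" using a by (simp add: alt_seq_def)
    have st: "(x # ys) ! k * (x # ys) ! Suc k = -1" if "Suc k < length (x # ys)" for k
      using a that unfolding alt_seq_def by blast
    have y: "y = -1" using st[of 0] x Cons by simp
    have zs: "zs \<noteq> []" using a Cons y by (auto simp: alt_seq_def)
    have "hd zs = 1" using st[of 1] Cons y zs by (cases zs) auto
    moreover have "last zs = 1" using a Cons zs by (simp add: alt_seq_def)
    moreover have "zs ! k * zs ! Suc k = -1" if "Suc k < length zs" for k
      using st[of "Suc (Suc k)"] Cons that by simp
    ultimately show "x = 1 \<and> (ys = [] \<or> (\<exists>zs. ys = -1 # zs \<and> alt_seq zs))"
      using x y zs Cons by (simp add: alt_seq_def)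
  next
    assume a: "x = 1 \<and> (ys = [] \<or> (\<exists>zs. ys = -1 # zs \<and> alt_seq zs))"
    then have x: "x = 1" and y: "y = -1" and zs: "alt_seq zs" using Cons by auto
    have "(x # ys) ! k * (x # ys) ! Suc k = -1" if "Suc k < length (x # ys)" for k
    proof (cases k)
      case 0 then show ?thesis using x y Cons by simp
    next
      case (Suc k')
      show ?thesis
      proof (cases k')
        case 0 then show ?thesis using Suc y Cons zs by (auto simp: alt_seq_def hd_conv_nth)
      next
        case (Suc k'')
        then show ?thesis using \<open>k = Suc k'\<close> that Cons zs by (auto simp: alt_seq_def)
      qed
    qed
    then show "alt_seq (x # ys)" using x zs Cons by (simp add: alt_seq_def)
  qed
qed

text \<open>The two states of a left-to-right reading are treated together: partial sum 0, and
  partial sum 1, modelled by the prepended 1. A nonzero entry exchanges the states, so the induction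
  needs both halves.\<close>

lemma alt_seq_filter_iff_partial_sums:
  fixes xs :: "int list"
  assumes "set xs \<subseteq> {-1, 0, 1}"
  shows "(alt_seq (filter (\<lambda>x. x \<noteq> 0) xs) \<longleftrightarrow>
           (\<forall>m\<le>length xs. sum_list (take m xs) \<in> {0, 1}) \<and> sum_list xs = 1)
       \<and> (alt_seq (1 # filter (\<lambda>x. x \<noteq> 0) xs) \<longleftrightarrow>
           (\<forall>m\<le>length xs. 1 + sum_list (take m xs) \<in> {0, 1}) \<and> sum_list xs = 0)"
  using assms
proof (induction xs)
  case Nil
  then show ?case by (simp add: alt_seq_def)
next
  case (Cons x xs)
  \<comment> \<open>The empty prefix gives the condition on the starting value \<open>s\<close>; all
    other prefixes start at \<open>s + x\<close>.\<close>
  have split: "(\<forall>m\<le>length (x # xs). s + sum_list (take m (x # xs)) \<in> {0, 1}) \<longleftrightarrow>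
      s \<in> {0, 1} \<and> (\<forall>m\<le>length xs. (s + x) + sum_list (take m xs) \<in> {0, 1})" for s :: int
  proof -
    have "(\<forall>m\<le>Suc l. Q m) \<longleftrightarrow> Q 0 \<and> (\<forall>m\<le>l. Q (Suc m))" for Q and l :: nat
      by (metis Suc_le_mono le0 not0_implies_Suc)
    then show ?thesis by (simp add: add.assoc)
  qed
  note split0 = split[of 0, simplified] and split1 = split[of 1]
  \<comment> \<open>A start outside 0 and 1 fails at the empty prefix. This excludes -1 in the first
    state and 1 in the second.\<close>
  have bad: "\<not> (\<forall>m\<le>length xs. t + sum_list (take m xs) \<in> {0, 1})" if "t \<notin> {0, 1}" for t :: int
    using that by (auto intro!: exI[of _ 0])
  from Cons.prems consider "x = -1" | "x = 0" | "x = 1" by auto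
  then show ?case
  proof cases
    case 1
    show ?thesis unfolding split1
      using Cons 1 bad[of "-1"] split0 by (auto simp: alt_seq_Cons)
  next
    case 2
    show ?thesis unfolding split1
      using Cons 2 split0 by auto
  next
    case 3
    show ?thesis unfolding split1
      using Cons 3 bad[of 2] split0 by (auto simp: alt_seq_Cons)
  qed
qed

lemma sum_list_take_map_upt:
  assumes "m \<le> n"
  shows "sum_list (take m (map g [1..<Suc n])) = (\<Sum>j\<in>{1..m}. g j :: int)"
proof -
  have "take m (map g [1..<Suc n]) = map g [1..<Suc m]"
    using assms by (simp add: take_map take_upt del: upt_Suc)
  then show ?thesis
    by (simp add: sum_list_distinct_conv_sum_set atLeastLessThanSuc_atLeastAtMost del: upt_Suc)
qed

lemma alt_seq_map_iff:
  fixes g :: "nat \<Rightarrow> int"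
  assumes "\<forall>j. g j \<in> {-1, 0, 1}"
  shows "alt_seq (filter (\<lambda>x. x \<noteq> 0) (map g [1..<Suc n])) \<longleftrightarrow>
    (\<forall>m\<le>n. (\<Sum>j\<in>{1..m}. g j) \<in> {0, 1}) \<and> (\<Sum>j\<in>{1..n}. g j) = 1"
proof -
  let ?xs = "map g [1..<Suc n]"
  have s: "sum_list ?xs = (\<Sum>j\<in>{1..n}. g j)"
    using sum_list_take_map_upt[of n n g] by (simp del: upt_Suc)
  have l: "length ?xs = n" by (simp del: upt_Suc)
  have "set ?xs \<subseteq> {-1, 0, 1}" using assms by auto
  have *: "(\<forall>m\<le>n. sum_list (take m ?xs) \<in> {0, 1}) \<longleftrightarrow> (\<forall>m\<le>n. (\<Sum>j\<in>{1..m}. g j) \<in> {0, 1})"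
    using sum_list_take_map_upt[of _ n g] by (metis (no_types, lifting))
  from conjunct1[OF alt_seq_filter_iff_partial_sums[OF \<open>set ?xs \<subseteq> _\<close>]] show ?thesis
    unfolding s l * .
qed

lemma is_asm_iff_partial_sums:
  "is_asm n A \<longleftrightarrow>
    (\<forall>i j. (i < 1 \<or> n < i \<or> j < 1 \<or> n < j) \<longrightarrow> A i j = 0) \<and>
    (\<forall>i j. A i j \<in> {-1, 0, 1}) \<and>
    (\<forall>i\<in>{1..n}. (\<forall>m\<le>n. (\<Sum>j\<in>{1..m}. A i j) \<in> {0, 1}) \<and> (\<Sum>j\<in>{1..n}. A i j) = 1) \<and>
    (\<forall>j\<in>{1..n}. (\<forall>m\<le>n. (\<Sum>i\<in>{1..m}. A i j) \<in> {0, 1}) \<and> (\<Sum>i\<in>{1..n}. A i j) = 1)"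
  (is "_ \<longleftrightarrow> ?Z \<and> ?V \<and> ?R \<and> ?C")
proof -
  have "alt_seq (row_nz n A i) \<longleftrightarrow>
      (\<forall>m\<le>n. (\<Sum>j\<in>{1..m}. A i j) \<in> {0, 1}) \<and> (\<Sum>j\<in>{1..n}. A i j) = 1" if ?V for i
    unfolding row_nz_def by (rule alt_seq_map_iff) (use that in simp)
  moreover have "alt_seq (col_nz n A j) \<longleftrightarrow>
      (\<forall>m\<le>n. (\<Sum>i\<in>{1..m}. A i j) \<in> {0, 1}) \<and> (\<Sum>i\<in>{1..n}. A i j) = 1" if ?V for j
    unfolding col_nz_def by (rule alt_seq_map_iff) (use that in simp)
  ultimately show ?thesis unfolding is_asm_def by (simp cong: conj_cong)
qed

lemma sum_zero_one_eq_card: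
  fixes g :: "nat \<Rightarrow> int"
  assumes "finite S" "\<And>j. j \<in> S \<Longrightarrow> g j \<in> {0, 1}"
  shows "sum g S = int (card {j \<in> S. g j = 1})"
proof -
  have "sum g S = (\<Sum>j\<in>S. if g j = 1 then 1 else 0)"
    using assms(2) by (intro sum.cong) auto
  also have "\<dots> = int (card {j \<in> S. g j = 1})"
    using assms(1) by (simp add: sum.If_cases Int_def)
  finally show ?thesis .
qed

lemma sum_one_unique:
  fixes g :: "nat \<Rightarrow> int"
  assumes "finite S" "\<And>j. j \<in> S \<Longrightarrow> g j \<in> {0, 1}" "sum g S = 1"
  obtains a where "a \<in> S" "g a = 1" "\<And>j. j \<in> S \<Longrightarrow> j \<noteq> a \<Longrightarrow> g j = 0"
proof -
  have "card {j \<in> S. g j = 1} = 1" using sum_zero_one_eq_card[OF assms(1,2)] assms(3) by simp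
  then obtain a where a: "{j \<in> S. g j = 1} = {a}" by (auto simp: card_1_singleton_iff)
  show thesis
  proof (rule that)
    show "a \<in> S" "g a = 1" using a by auto
    show "g j = 0" if "j \<in> S" "j \<noteq> a" for j using a that assms(2)[of j] by auto
  qed
qed

text \<open>Just before \<open>q\<close> the partial sum must be 1, since subtracting 1 has to leave
  0 or 1. So the entries before \<open>q\<close> sum to 1, and hence so do those after it; being 0
  or 1, they contain one 1 on each side.\<close>

lemma partial_sums_one_minus:
  fixes g :: "nat \<Rightarrow> int"
  assumes ps: "\<forall>m\<le>n. (\<Sum>j\<in>{1..m}. g j) \<in> {0, 1}" and tot: "(\<Sum>j\<in>{1..n}. g j) = 1"
    and q: "q \<in> {1..n}" "g q = -1"
    and rest: "\<And>j. j \<noteq> q \<Longrightarrow> g j \<in> {0, 1}"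
  obtains a b where "1 \<le> a" "a < q" "q < b" "b \<le> n" "g a = 1" "g b = 1"
    "\<And>j. j \<in> {1..n} \<Longrightarrow> j \<notin> {a, q, b} \<Longrightarrow> g j = 0"
proof -
  have "{1..q} = insert q {1..<q}" using q by auto
  then have s: "(\<Sum>j\<in>{1..q}. g j) = (\<Sum>j\<in>{1..<q}. g j) - 1" using q by simp
  have "{1..<q} = {1..q-1}" by auto
  then have "(\<Sum>j\<in>{1..<q}. g j) \<in> {0, 1}" using ps q by (auto dest!: spec[of _ "q-1"])
  then have l: "(\<Sum>j\<in>{1..<q}. g j) = 1" using s ps q by auto
  have "{1..n} = {1..q} \<union> {q<..n}" using q by auto
  then have "(\<Sum>j\<in>{1..n}. g j) = (\<Sum>j\<in>{1..q}. g j) + (\<Sum>j\<in>{q<..n}. g j)"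
    by (simp add: sum.union_disjoint[symmetric] ivl_disj_int)
  then have r: "(\<Sum>j\<in>{q<..n}. g j) = 1" using l s tot by simp
  obtain a where a: "a \<in> {1..<q}" "g a = 1" "\<And>j. j \<in> {1..<q} \<Longrightarrow> j \<noteq> a \<Longrightarrow> g j = 0"
    by (rule sum_one_unique[OF _ _ l]) (use rest in auto)
  obtain b where b: "b \<in> {q<..n}" "g b = 1" "\<And>j. j \<in> {q<..n} \<Longrightarrow> j \<noteq> b \<Longrightarrow> g j = 0"
    by (rule sum_one_unique[OF _ _ r]) (use rest in auto)
  show thesis
  proof (rule that[of a b])
    show "g j = 0" if "j \<in> {1..n}" "j \<notin> {a, q, b}" for j
      using that a(3)[of j] b(3)[of j] by (cases "j < q") auto
  qed (use a(1,2) b(1,2) in auto)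
qed

section \<open>Alternating sign matrices with one negative entry\<close>

definition permmat :: "nat \<Rightarrow> (nat \<Rightarrow> nat) \<Rightarrow> mat" where
  "permmat n f i j = of_bool (i \<in> {1..n} \<and> j = f i)"

definition asmat :: "nat \<Rightarrow> (nat \<Rightarrow> nat) \<Rightarrow> nat \<Rightarrow> nat \<Rightarrow> nat \<Rightarrow> mat" where
  "asmat n h p q b i j = permmat n h i j
     + (if i = p then of_bool (j = b) - of_bool (j = q) else 0)"

text \<open>\<open>h\<close> meets column \<open>h k\<close> twice, in rows \<open>k\<close> and
  \<open>m\<close>, and misses \<open>b\<close>; sending \<open>m\<close> to \<open>b\<close>
  repairs both defects. One bijection thus replaces the row and column conditions.\<close>

locale one_minus =
  fixes n :: nat and h :: "nat \<Rightarrow> nat" and k p m b :: nat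
  assumes k1: "1 \<le> k" and kp: "k < p" and pm: "p < m" and mn: "m \<le> n"
    and hm: "h m = h k" and hp: "h p < h k" and hb: "h k < b"
    and bij: "bij_betw (h(m := b)) {1..n} {1..n}"
begin

abbreviation "q \<equiv> h k"
abbreviation "A \<equiv> asmat n h p q b"

lemma b_range: "b \<in> {1..n}"
  using bij_betwE[OF bij, THEN bspec, of m] kp pm mn by simp

lemma h_range: "i \<in> {1..n} \<Longrightarrow> h i \<in> {1..n}"
proof -
  assume i: "i \<in> {1..n}"
  have "h i \<in> {1..n}" if "i \<noteq> m" "i \<in> {1..n}" for i
    using bij_betwE[OF bij, THEN bspec, of i] that by simp
  from this[of i] this[of k] show ?thesis using i hm k1 kp pm mn by (cases "i = m") auto
qed

lemma h_neq_b: "i \<in> {1..n} \<Longrightarrow> h i \<noteq> b"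
proof
  assume i: "i \<in> {1..n}" "h i = b"
  then have "i \<noteq> m" using hm hb by auto
  then have "(h(m := b)) i = (h(m := b)) m" using i(2) by simp
  moreover have "m \<in> {1..n}" using kp pm mn by simp
  ultimately have "i = m" using inj_onD[OF bij_betw_imp_inj_on[OF bij]] i(1) by blast
  then show False using \<open>i \<noteq> m\<close> by blast
qed

lemma h_inj: "i \<in> {1..n} \<Longrightarrow> i' \<in> {1..n} \<Longrightarrow> h i = h i' \<Longrightarrow> i = i' \<or> i = k \<and> i' = m \<or> i = m \<and> i' = k"
proof -
  have *: "i = i'" if "i \<in> {1..n}" "i' \<in> {1..n}" "h i = h i'" "i \<noteq> m" "i' \<noteq> m" for i i'
    using inj_onD[OF bij_betw_imp_inj_on[OF bij], of i i'] that by auto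
  assume i: "i \<in> {1..n}" "i' \<in> {1..n}" "h i = h i'"
  have kn: "k \<in> {1..n}" "k \<noteq> m" using k1 kp pm mn by auto
  show ?thesis
    using * i kn hm by metis
qed

lemma h_eq_q_iff: "i \<in> {1..n} \<Longrightarrow> h i = q \<longleftrightarrow> i = k \<or> i = m"
  using h_inj[of i k] hm k1 kp pm mn by auto

lemma inj_on_h: "k \<notin> S \<or> m \<notin> S \<Longrightarrow> S \<subseteq> {1..n} \<Longrightarrow> inj_on h S"
  using h_inj by (intro inj_onI) (metis subsetD)

lemma h_surj: "j \<in> {1..n} \<Longrightarrow> j \<noteq> b \<Longrightarrow> \<exists>i\<in>{1..n}. h i = j"
proof -
  assume j: "j \<in> {1..n}" "j \<noteq> b"
  have "h(m := b) ` {1..n} = {1..n}" using bij by (simp add: bij_betw_def)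
  then obtain i where "i \<in> {1..n}" "(h(m := b)) i = j" using j(1) by (metis imageE)
  then show ?thesis using j by (auto split: if_splits)
qed

lemma A_eq_1_iff: "A i j = 1 \<longleftrightarrow> i \<in> {1..n} \<and> (j = h i \<or> i = p \<and> j = b)"
  using h_neq_b[of p] hp hb kp pm mn by (auto simp: asmat_def permmat_def)

lemma A_eq_minus_iff: "A i j = -1 \<longleftrightarrow> i = p \<and> j = q"
  using h_neq_b[of p] hp hb kp pm mn by (auto simp: asmat_def permmat_def)

lemma A_range: "A i j \<in> {-1, 0, 1}"
  using h_neq_b[of p] hp hb kp pm mn by (auto simp: asmat_def permmat_def)

lemma A_outside: "i \<notin> {1..n} \<or> j \<notin> {1..n} \<Longrightarrow> A i j = 0"
  using h_range[of i] h_range[of k] b_range k1 kp pm mn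
  by (auto simp: asmat_def permmat_def)

text \<open>The weight \<open>F\<close> is arbitrary because it is a constant for partial sums, an
  indicator for inversions and a row of \<open>A\<close> itself for squares.\<close>

lemma row_sum:
  fixes F :: "nat \<Rightarrow> int"
  assumes "i \<in> {1..n}" "finite S"
  shows "(\<Sum>j\<in>S. A i j * F j) = of_bool (h i \<in> S) * F (h i)
    + (if i = p then of_bool (b \<in> S) * F b - of_bool (q \<in> S) * F q else 0)"
proof -
  have 1: "(\<Sum>j\<in>S. of_bool (j = t) * F j) = of_bool (t \<in> S) * F t" for t
    using assms(2) by (simp add: of_bool_def if_distrib[of "\<lambda>x. x * _"] cong: if_cong)
  have "(\<Sum>j\<in>S. A i j * F j) = (\<Sum>j\<in>S. of_bool (j = h i) * F j)
      + (if i = p then (\<Sum>j\<in>S. of_bool (j = b) * F j) - (\<Sum>j\<in>S. of_bool (j = q) * F j) else 0)"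
    using assms(1)
    by (auto simp: asmat_def permmat_def algebra_simps sum.distrib sum_subtractf)
  then show ?thesis unfolding 1 .
qed

text \<open>In column \<open>q\<close> the rows \<open>k\<close>, \<open>p\<close>, \<open>m\<close>
  contribute 1, -1, 1; column \<open>b\<close> gets its only 1 from row \<open>p\<close>;
  \<open>h\<close> meets every other column at most once.\<close>

lemma col_partial_sum:
  assumes "j \<in> {1..n}" "t \<le> n"
  shows "(\<Sum>i\<in>{1..t}. A i j) =
    (if j = q then of_bool (k \<le> t) - of_bool (p \<le> t) + of_bool (m \<le> t)
     else if j = b then of_bool (p \<le> t)
     else of_bool (\<exists>i\<in>{1..t}. h i = j))"
proof -
  have "(\<Sum>i\<in>{1..t}. A i j) = (\<Sum>i\<in>{1..t}. of_bool (h i = j))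
      + (\<Sum>i\<in>{1..t}. if i = p then of_bool (j = b) - of_bool (j = q) else 0)"
    unfolding sum.distrib[symmetric] using assms
    by (intro sum.cong) (auto simp: asmat_def permmat_def)
  also have "(\<Sum>i\<in>{1..t}. if i = p then of_bool (j = b) - of_bool (j = q) else (0::int)) =
      of_bool (p \<le> t) * (of_bool (j = b) - of_bool (j = q))"
    using k1 kp by (simp add: of_bool_def)
  also have "(\<Sum>i\<in>{1..t}. of_bool (h i = j) :: int) = int (card {i\<in>{1..t}. h i = j})"
    by (simp add: of_bool_def sum.If_cases Int_def)
  finally have *: "(\<Sum>i\<in>{1..t}. A i j) = int (card {i\<in>{1..t}. h i = j})
      + of_bool (p \<le> t) * (of_bool (j = b) - of_bool (j = q))" .
  consider "j = q" | "j = b" | "j \<noteq> q" "j \<noteq> b" by blast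
  then show ?thesis
  proof cases
    case 1
    have "{i\<in>{1..t}. h i = j} = (if k \<le> t then {k} else {}) \<union> (if m \<le> t then {m} else {})"
      using h_eq_q_iff 1 assms k1 kp pm mn by auto
    then show ?thesis using * 1 kp pm hb by auto
  next
    case 2
    have e: "{i\<in>{1..t}. h i = j} = {}" using h_neq_b 2 assms by auto
    show ?thesis using *[unfolded e] 2 hb by simp
  next
    case 3
    have "int (card {i\<in>{1..t}. h i = j}) = of_bool (\<exists>i\<in>{1..t}. h i = j)"
    proof (cases "\<exists>i\<in>{1..t}. h i = j")
      case True
      then obtain i where i: "i \<in> {1..t}" "h i = j" by blast
      have "i' = i" if "i' \<in> {1..t}" "h i' = j" for i'
      proof -
        have "i' = i \<or> i' = k \<and> i = m \<or> i' = m \<and> i = k" using h_inj[of i' i] i that assms(2) by auto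
        then show ?thesis using that i 3 hm by auto
      qed
      then have "{i\<in>{1..t}. h i = j} = {i}" using i by blast
      then show ?thesis using True by simp
    next
      case False
      then have e: "{i\<in>{1..t}. h i = j} = {}" by auto
      show ?thesis unfolding e using False by simp
    qed
    then show ?thesis using * 3 by simp
  qed
qed

lemma is_asm_A: "is_asm n A"
  unfolding is_asm_iff_partial_sums
proof (intro conjI allI ballI impI)
  fix i j
  show "A i j = 0" if "i < 1 \<or> n < i \<or> j < 1 \<or> n < j" using A_outside[of i j] that by auto
  show "A i j \<in> {-1, 0, 1}" by (rule A_range)
next
  fix i t assume i: "i \<in> {1..n}"
  have pos: "1 \<le> h i" "1 \<le> q" "1 \<le> b" using h_range[of i] h_range[of k] i b_range k1 kp pm mn by auto
  show "(\<Sum>j\<in>{1..t}. A i j) \<in> {0, 1}" if "t \<le> n"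
    using row_sum[OF i, of "{1..t}" "\<lambda>_. 1"] pos hp hb by auto
  show "(\<Sum>j\<in>{1..n}. A i j) = 1"
    using row_sum[OF i, of "{1..n}" "\<lambda>_. 1"] h_range[of i] h_range[of k] i b_range k1 kp pm mn by auto
next
  fix j t assume j: "j \<in> {1..n}"
  show "(\<Sum>i\<in>{1..t}. A i j) \<in> {0, 1}" if "t \<le> n"
    using col_partial_sum[OF j that] kp pm by auto
  show "(\<Sum>i\<in>{1..n}. A i j) = 1"
    using col_partial_sum[OF j order_refl] kp pm mn h_surj[OF j] by auto
qed

lemma A_in_asm_set: "A \<in> asm_set n 1"
proof -
  have "{(i, j). A i j = -1} = {(p, q)}" using A_eq_minus_iff by auto
  then show ?thesis using is_asm_A by (simp add: asm_set_def)
qed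

lemma minus_pos_A: "minus_pos A = (p, q)"
  unfolding minus_pos_def A_eq_minus_iff by (rule the_equality) (auto simp: prod_eq_iff)

lemma closing_row_A: "closing_row A = p" and opening_col_A: "opening_col A = q"
  by (simp_all add: closing_row_def opening_col_def minus_pos_A)

lemma opening_row_A: "opening_row A = k"
  unfolding opening_row_def closing_row_A opening_col_A A_eq_1_iff
proof (rule the_equality)
  show "k < p \<and> k \<in> {1..n} \<and> (q = q \<or> k = p \<and> q = b)" using k1 kp pm mn by auto
  show "i = k" if "i < p \<and> i \<in> {1..n} \<and> (q = h i \<or> i = p \<and> q = b)" for i
    using h_eq_q_iff[of i] that pm by auto
qed

lemma closing_col_A: "closing_col A = b"
  unfolding closing_col_def closing_row_A opening_col_A A_eq_1_iff
  using k1 kp pm mn hb hp by (intro the_equality) auto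

lemmas pars_A = closing_row_A opening_col_A opening_row_A closing_col_A

lemma is_neutral_A: "is_neutral A \<longleftrightarrow> p = Suc k"
  by (simp add: is_neutral_def pars_A)

lemma lowest_enclosed_col_A: "p \<noteq> Suc k \<Longrightarrow> lowest_enclosed_col A = h (p - 1)"
  unfolding lowest_enclosed_col_def pars_A A_eq_1_iff
  using k1 kp pm mn by (intro the_equality) auto

lemma is_positive_A: "is_positive A \<longleftrightarrow> p \<noteq> Suc k \<and> q < h (p - 1)"
  using lowest_enclosed_col_A by (auto simp: is_positive_def is_neutral_A pars_A)

lemma is_negative_A: "is_negative A \<longleftrightarrow> p \<noteq> Suc k \<and> h (p - 1) < q"
  using lowest_enclosed_col_A by (auto simp: is_negative_def is_neutral_A pars_A)

lemma nonneg_A: "is_positive A \<or> is_neutral A \<longleftrightarrow> p = Suc k \<or> q < h (p - 1)"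
  by (auto simp: is_positive_A is_neutral_A)

text \<open>The 1 of the lowest enclosed row cannot lie in column \<open>q\<close>, which
  \<open>h\<close> meets only in rows \<open>k\<close> and \<open>m\<close>.\<close>

lemma not_negative_A: "\<not> is_negative A \<longleftrightarrow> is_positive A \<or> is_neutral A"
proof -
  have "h (p - 1) \<noteq> q" if "p \<noteq> Suc k"
    using that h_eq_q_iff[of "p - 1"] k1 kp pm mn by (auto simp: le_diff_conv)
  then show ?thesis by (auto simp: is_positive_A is_neutral_A is_negative_A)
qed

text \<open>The charged, closing and leading cells all avoid the -1 and the closing 1, so their sums
  count values of \<open>h\<close>.\<close>

lemma cell_sum:
  assumes "R \<subseteq> {1..n}" "finite S" "p \<in> R \<Longrightarrow> q \<notin> S \<and> b \<notin> S"
  shows "(\<Sum>i\<in>R. \<Sum>j\<in>S. A i j) = (\<Sum>i\<in>R. of_bool (h i \<in> S))"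
proof (rule sum.cong)
  fix i assume i: "i \<in> R"
  show "(\<Sum>j\<in>S. A i j) = of_bool (h i \<in> S)"
    using row_sum[OF subsetD[OF assms(1) i] assms(2), of "\<lambda>_. 1"] assms(3) i by auto
qed simp

lemma charge_cell_A: "charge_cell n A = (\<Sum>i\<in>{k<..<p}. of_bool (q < h i))"
proof -
  have "(\<Sum>i\<in>{k<..<p}. of_bool (h i \<in> {q<..n})) = (\<Sum>i\<in>{k<..<p}. of_bool (q < h i) :: int)"
    using h_range kp pm mn by (intro sum.cong) auto
  then show ?thesis
    unfolding charge_cell_def pars_A using kp pm mn by (subst cell_sum) auto
qed

lemma cpar_A: "cpar n A = (\<Sum>i\<in>{p<..n}. of_bool (q < h i \<and> h i < b))"
  unfolding cpar_def pars_A using kp pm mn by (subst cell_sum) auto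

text \<open>Row \<open>p\<close> has a 1 on the left, so the search for the leading 1 ends at
  \<open>p\<close> at the latest.\<close>

lemma leading_row_A: "leading_row A = nxt (insert p {i \<in> {k<..<p}. h i < q}) k"
  unfolding leading_row_def pars_A nxt_def
proof (rule Least_equality)
  let ?S = "{y \<in> insert p {i \<in> {k<..<p}. h i < q}. k < y}"
  have fin: "finite ?S" by simp
  have "p \<in> ?S" using kp by simp
  with fin have mem: "Min ?S \<in> ?S" using Min_in by blast
  then have "h (Min ?S) < q" "k < Min ?S" "Min ?S \<in> {1..n}" using hp kp pm mn k1 by auto
  then show "k < Min ?S \<and> (\<exists>j\<ge>1. j < q \<and> A (Min ?S) j = 1)"
    using h_range[of "Min ?S"] by (auto simp: A_eq_1_iff)
  fix y assume y: "k < y \<and> (\<exists>j\<ge>1. j < q \<and> A y j = 1)"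
  then have hy: "h y < q" using hb by (auto simp: A_eq_1_iff)
  show "Min ?S \<le> y"
  proof (cases "y \<le> p")
    case True
    then show ?thesis using y hy fin by (intro Min_le) auto
  next
    case False
    then show ?thesis using \<open>p \<in> ?S\<close> fin Min_le[OF fin \<open>p \<in> ?S\<close>] by linarith
  qed
qed

lemma leading_col_A: "leading_col A = h (nxt (insert p {i \<in> {k<..<p}. h i < q}) k)"
proof -
  let ?S = "{i \<in> {k<..<p}. h i < q}"
  interpret I: interlacing ?S k p by unfold_locales (use kp in auto)
  let ?r = "nxt (insert p ?S) k"
  have r: "?r \<in> {1..n}" "h ?r < q" using I.nxt_props(1)[of k] kp pm mn hp k1 by auto
  show ?thesis unfolding leading_col_def leading_row_A pars_A A_eq_1_iff
    using r h_range[of ?r] hb by (intro the_equality) auto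
qed

lemma ell_A: "ell n A = (\<Sum>i\<in>{k<..n}. of_bool (leading_col A < h i \<and> h i < q))"
  unfolding ell_def pars_A using hb by (subst cell_sum) auto

end

text \<open>The partial sums of row \<open>p\<close> and of column \<open>q\<close> yield
  \<open>a\<close>, \<open>b\<close> and \<open>k\<close>, \<open>m\<close> around the -1. Every
  other row is nonnegative with sum 1, which defines \<open>h\<close>; the column sums make
  \<open>h(m := b)\<close> surjective, hence bijective.\<close>

lemma asm_set_1_obtain:
  assumes "A \<in> asm_set n 1"
  obtains h k p m b where "one_minus n h k p m b" "A = asmat n h p (h k) b"
proof -
  have asm: "is_asm n A" and "card {(i, j). A i j = -1} = 1" using assms by (auto simp: asm_set_def)
  then obtain x where "{(i, j). A i j = -1} = {x}" by (auto simp: card_1_singleton_iff)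
  moreover obtain p q where "x = (p, q)" by (cases x)
  ultimately have "{(i, j). A i j = -1} = {(p, q)}" by simp
  then have pq: "A i j = -1 \<longleftrightarrow> i = p \<and> j = q" for i j by (auto simp: set_eq_iff)
  from asm have zero: "\<And>i j. i \<notin> {1..n} \<or> j \<notin> {1..n} \<Longrightarrow> A i j = 0"
    and val: "\<And>i j. A i j \<in> {-1, 0, 1}"
    and row: "\<And>i. i \<in> {1..n} \<Longrightarrow> (\<forall>m\<le>n. (\<Sum>j\<in>{1..m}. A i j) \<in> {0, 1})"
      "\<And>i. i \<in> {1..n} \<Longrightarrow> (\<Sum>j\<in>{1..n}. A i j) = 1"
    and col: "\<And>j. j \<in> {1..n} \<Longrightarrow> (\<forall>m\<le>n. (\<Sum>i\<in>{1..m}. A i j) \<in> {0, 1})"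
      "\<And>j. j \<in> {1..n} \<Longrightarrow> (\<Sum>i\<in>{1..n}. A i j) = 1"
    unfolding is_asm_iff_partial_sums by (auto simp: not_le)
  have val': "A i j \<in> {0, 1}" if "i \<noteq> p \<or> j \<noteq> q" for i j
    using val[of i j] pq[of i j] that by auto
  have rng: "p \<in> {1..n}" "q \<in> {1..n}" using zero[of p q] pq[of p q] by auto
  obtain a b where ab: "1 \<le> a" "a < q" "q < b" "b \<le> n" "A p a = 1" "A p b = 1"
    "\<And>j. j \<in> {1..n} \<Longrightarrow> j \<notin> {a, q, b} \<Longrightarrow> A p j = 0"
    by (rule partial_sums_one_minus[OF row[OF rng(1)] rng(2)]) (use pq val' in auto)
  obtain k m where km: "1 \<le> k" "k < p" "p < m" "m \<le> n" "A k q = 1" "A m q = 1"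
    "\<And>i. i \<in> {1..n} \<Longrightarrow> i \<notin> {k, p, m} \<Longrightarrow> A i q = 0"
    by (rule partial_sums_one_minus[of n "\<lambda>i. A i q", OF col[OF rng(2)] rng(1)]) (use pq val' in auto)
  have "\<exists>c. A i c = 1 \<and> (\<forall>j. A i j = 1 \<longrightarrow> j = c)" if i: "i \<in> {1..n}" "i \<noteq> p" for i
  proof -
    obtain c where "c \<in> {1..n}" "A i c = 1" "\<And>j. j \<in> {1..n} \<Longrightarrow> j \<noteq> c \<Longrightarrow> A i j = 0"
      by (rule sum_one_unique[OF _ _ row(2)[OF i(1)]]) (use val' i in auto)
    then show ?thesis using zero by (intro exI[of _ c]) (metis zero_neq_one)
  qed
  then obtain g where g: "\<And>i. i \<in> {1..n} \<Longrightarrow> i \<noteq> p \<Longrightarrow> A i (g i) = 1"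
    "\<And>i j. i \<in> {1..n} \<Longrightarrow> i \<noteq> p \<Longrightarrow> A i j = 1 \<Longrightarrow> j = g i" by metis
  \<comment> \<open>\<open>g\<close> is unconstrained at \<open>p\<close>, whose row has two 1s; the
    left one is chosen.\<close>
  define h where "h = g(p := a)"
  have h: "A i (h i) = 1" if "i \<in> {1..n}" for i using g(1)[OF that] ab by (auto simp: h_def)
  have h_uniq: "j = h i" if "i \<in> {1..n}" "i \<noteq> p" "A i j = 1" for i j
    using g(2)[OF that] that by (auto simp: h_def)
  have hk: "h k = q" using h_uniq[of k q] km rng by auto
  have hm: "h m = q" using h_uniq[of m q] km rng by auto
  have hr: "h i \<in> {1..n}" if "i \<in> {1..n}" for i using h[OF that] zero[of i "h i"] by fastforce
  have surj: "{1..n} \<subseteq> h(m := b) ` {1..n}"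
  proof
    fix j assume j: "j \<in> {1..n}"
    show "j \<in> h(m := b) ` {1..n}"
    proof (cases "j = q \<or> j = b")
      case True
      then show ?thesis
        using hk km by (auto intro: image_eqI[of _ _ k] image_eqI[of _ _ m])
    next
      case False
      obtain i where i: "i \<in> {1..n}" "A i j = 1"
        by (rule sum_one_unique[OF _ _ col(2)[OF j]]) (use val' False in auto)
      have "j = h i"
      proof (cases "i = p")
        case True
        then show ?thesis using ab(7)[OF j] i False by (auto simp: h_def)
      qed (use h_uniq i in auto)
      moreover have "i \<noteq> m" using calculation hm False by auto
      ultimately show ?thesis using i by (intro image_eqI[of _ _ i]) auto
    qed
  qed
  moreover have sub: "h(m := b) ` {1..n} \<subseteq> {1..n}" using hr ab by auto
  ultimately have eq: "h(m := b) ` {1..n} = {1..n}" by blast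
  then have "inj_on (h(m := b)) {1..n}" by (intro eq_card_imp_inj_on) auto
  then have bij: "bij_betw (h(m := b)) {1..n} {1..n}" using eq by (simp add: bij_betw_def)
  have "one_minus n h k p m b"
    by unfold_locales (use km ab hk hm bij in \<open>auto simp: h_def\<close>)
  moreover have "A = asmat n h p (h k) b"
  proof (intro ext)
    fix i j
    show "A i j = asmat n h p (h k) b i j"
    proof (cases "i = p")
      case True
      then show ?thesis
        using ab pq[of p j] rng zero[of p j] hk by (auto simp: asmat_def permmat_def h_def)
    next
      case False
      then have "A i j = permmat n h i j"
        using h[of i] h_uniq[of i j] val'[of i j] zero[of i j] unfolding permmat_def
        by (metis (full_types) empty_iff insert_iff of_bool_eq(1) of_bool_eq(2))
      then show ?thesis using False by (simp add: asmat_def)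
    qed
  qed
  ultimately show thesis by (rule that)
qed

section \<open>The discharged permutation\<close>

lemma sum_of_bool_neq_0_iff:
  "finite S \<Longrightarrow> (\<Sum>i\<in>S. of_bool (P i)) \<noteq> (0::int) \<longleftrightarrow> (\<exists>i\<in>S. P i)"
  by (subst sum_nonneg_eq_0_iff) auto

text \<open>Equal sums for all weights say that \<open>f\<close> and \<open>g\<close> take the same
  values with the same multiplicities. Indicators give surjectivity and finiteness gives the rest.
  Bijectivity of a piecewise shift thus reduces to a sum identity.\<close>

lemma bij_betw_if_sums_eq:
  fixes f g :: "nat \<Rightarrow> nat"
  assumes fin: "finite S" and g: "bij_betw g S S"
    and sums: "\<And>F :: nat \<Rightarrow> int. (\<Sum>i\<in>S. F (f i)) = (\<Sum>i\<in>S. F (g i))"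
  shows "bij_betw f S S"
proof -
  have sub: "S \<subseteq> f ` S"
  proof
    fix v assume "v \<in> S"
    then obtain i where i: "i \<in> S" "g i = v" using g by (metis bij_betw_imp_surj_on imageE)
    have "(1::int) \<le> (\<Sum>i\<in>S. of_bool (g i = v))"
      using i fin member_le_sum[of i S "\<lambda>i. of_bool (g i = v) :: int"] by simp
    then have "(\<Sum>i\<in>S. of_bool (f i = v)) \<noteq> (0::int)"
      using sums[of "\<lambda>x. of_bool (x = v)"] by linarith
    then obtain i where "i \<in> S" "f i = v" using sum_of_bool_neq_0_iff[OF fin, of "\<lambda>i. f i = v"] by blast
    then show "v \<in> f ` S" by blast
  qed
  have "card (f ` S) \<le> card S" using fin card_image_le by blast
  then have "f ` S = S" using sub fin by (metis card_seteq finite_imageI)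
  then show ?thesis using fin eq_card_imp_inj_on[of S f] by (auto simp: bij_betw_def)
qed

lemma sum_blocks:
  fixes G :: "nat \<Rightarrow> int"
  assumes "k \<le> p" "p \<le> n"
  shows "(\<Sum>i\<in>{1..n}. G i) = (\<Sum>i\<in>{1..k}. G i) + (\<Sum>i\<in>{k<..p}. G i) + (\<Sum>i\<in>{p<..n}. G i)"
    and "(\<Sum>i\<in>{k<..n}. G i) = (\<Sum>i\<in>{k<..p}. G i) + (\<Sum>i\<in>{p<..n}. G i)"
proof -
  have e: "{k<..n} = {k<..p} \<union> {p<..n}" "{1..n} = {1..k} \<union> {k<..n}" using assms by auto
  show 1: "(\<Sum>i\<in>{k<..n}. G i) = (\<Sum>i\<in>{k<..p}. G i) + (\<Sum>i\<in>{p<..n}. G i)"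
    unfolding e(1) by (rule sum.union_disjoint) auto
  have "(\<Sum>i\<in>{1..n}. G i) = (\<Sum>i\<in>{1..k}. G i) + (\<Sum>i\<in>{k<..n}. G i)"
    unfolding e(2) by (rule sum.union_disjoint) auto
  then show "(\<Sum>i\<in>{1..n}. G i) = (\<Sum>i\<in>{1..k}. G i) + (\<Sum>i\<in>{k<..p}. G i) + (\<Sum>i\<in>{p<..n}. G i)"
    using 1 by simp
qed

text \<open>The combined effect of the steps on the column of each row's 1. Vertical displacement
  raises a left entry to the previous row of \<open>insert k X\<close>, and lowering then makes row
  \<open>i\<close> read from row \<open>i - 1\<close>. Below \<open>p\<close>, the entries in
  columns from \<open>q\<close> to before \<open>b\<close> move to the next column of
  \<open>insert b Y\<close>.\<close>

definition discharge :: "nat \<Rightarrow> (nat \<Rightarrow> nat) \<Rightarrow> nat \<Rightarrow> nat \<Rightarrow> nat \<Rightarrow> nat \<Rightarrow> nat" where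
  "discharge n h k p b i =
    (let q = h k; X = {i \<in> {k<..<p}. h i < q}; Y = {j \<in> {q<..<b}. \<exists>i\<in>{p<..n}. h i = j} in
     if i \<le> k then h i
     else if i \<le> p then (if i - 1 \<in> insert k X then h (nxt (insert p X) (i - 1)) else h (i - 1))
     else if q \<le> h i \<and> h i < b then nxt (insert b Y) (h i) else h i)"

text \<open>Undoes \<open>discharge\<close> for known \<open>p\<close> and \<open>b\<close>. The
  condition defining \<open>X\<close> looks at \<open>Suc i\<close> because row \<open>i + 1\<close>
  of the discharged permutation has its entry on the side where row \<open>i\<close> had it.\<close>

definition recharge :: "nat \<Rightarrow> (nat \<Rightarrow> nat) \<Rightarrow> nat \<Rightarrow> nat \<Rightarrow> nat \<Rightarrow> nat \<Rightarrow> nat" where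
  "recharge n f k p b i =
    (let q = f k; X = {i \<in> {k<..<p}. f (Suc i) < q}; Y = {j \<in> {q<..<b}. \<exists>i\<in>{p<..n}. f i = j} in
     if i \<le> k then f i
     else if i \<le> p then (if i \<in> insert p X then f (Suc (prv (insert k X) i)) else f (Suc i))
     else if q < f i \<and> f i \<le> b then prv (insert q Y) (f i) else f i)"

section \<open>The discharged permutation and its statistics\<close>

context one_minus
begin

abbreviation "X \<equiv> {i \<in> {k<..<p}. h i < q}"
abbreviation "Y \<equiv> {j \<in> {q<..<b}. \<exists>i\<in>{p<..n}. h i = j}"
abbreviation "f \<equiv> discharge n h k p b"

sublocale Rows: interlacing X k p
  by unfold_locales (use kp in auto)

sublocale Cols: interlacing Y q b
  by unfold_locales (use hb in auto)

lemma f_upper: "i \<le> k \<Longrightarrow> f i = h i"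
  by (simp add: discharge_def)

lemma f_mid: "i \<in> {k..<p} \<Longrightarrow>
    f (Suc i) = h (if i \<in> insert k X then nxt (insert p X) i else i)"
  by (auto simp: discharge_def Let_def)

lemma f_low: "i \<in> {p<..n} \<Longrightarrow>
    f i = (if q \<le> h i \<and> h i < b then nxt (insert b Y) (h i) else h i)"
  using kp by (auto simp: discharge_def Let_def)

lemma f_low_in: "i \<in> {p<..n} \<Longrightarrow> q \<le> h i \<and> h i < b \<Longrightarrow> f i = nxt (insert b Y) (h i)"
  by (simp only: f_low if_True simp_thms)

lemma f_low_out: "i \<in> {p<..n} \<Longrightarrow> \<not> (q \<le> h i \<and> h i < b) \<Longrightarrow> f i = h i"
  by (simp only: f_low if_False)

lemma q_Y: "i \<in> {p<..n} \<Longrightarrow> q \<le> h i \<Longrightarrow> h i < b \<Longrightarrow> h i \<in> insert q Y"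
  by (auto simp: le_less)

lemma mid_right: "i \<in> {k<..<p} \<Longrightarrow> i \<notin> X \<Longrightarrow> q < h i"
  using h_eq_q_iff[of i] k1 pm mn by auto

lemma nxt_X: "i \<in> insert k X \<Longrightarrow> nxt (insert p X) i \<in> {k<..p} \<and> h (nxt (insert p X) i) < q"
  using Rows.nxt_props(1)[of i] hp kp by auto

text \<open>The interlacing shift on left rows combined with the identity on right rows: the source
  of row \<open>i + 1\<close> of \<open>f\<close> runs through all rows after \<open>k\<close> up to
  \<open>p\<close>.\<close>

lemma bij_mid: "bij_betw (\<lambda>i. if i \<in> insert k X then nxt (insert p X) i else i) {k..<p} {k<..p}"
proof -
  let ?a = "\<lambda>i. if i \<in> insert k X then nxt (insert p X) i else i"
  have "bij_betw ?a (insert k X) (insert p X)"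
    using Rows.bij_betw_nxt by (rule bij_betw_cong[THEN iffD1, rotated]) simp
  moreover have "bij_betw ?a ({k<..<p} - X) ({k<..<p} - X)"
    by (rule bij_betw_cong[THEN iffD1, rotated, OF bij_betw_id]) auto
  ultimately have "bij_betw ?a (insert k X \<union> ({k<..<p} - X)) (insert p X \<union> ({k<..<p} - X))"
    by (rule bij_betw_combine) auto
  moreover have "insert k X \<union> ({k<..<p} - X) = {k..<p}" "insert p X \<union> ({k<..<p} - X) = {k<..p}"
    using kp by auto
  ultimately show ?thesis by simp
qed

text \<open>Rows \<open>k + 1\<close> to \<open>p\<close> contain the same columns before and after
  discharging. The form with a weight serves bijectivity, charge, \<open>ell\<close> and inversions
  alike.\<close>

lemma mid_sum:
  fixes F :: "nat \<Rightarrow> int"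
  shows "(\<Sum>i\<in>{k<..p}. F (f i)) = (\<Sum>i\<in>{k<..p}. F (h i))"
proof -
  have "(\<Sum>i\<in>{k<..p}. F (f i)) = (\<Sum>i\<in>{k..<p}. F (f (Suc i)))"
    using sum.shift_bounds_Suc_ivl[of "\<lambda>i. F (f i)" k p]
    by (simp only: atLeastLessThanSuc_atLeastAtMost atLeastSucAtMost_greaterThanAtMost)
  also have "\<dots> = (\<Sum>i\<in>{k..<p}. F (h (if i \<in> insert k X then nxt (insert p X) i else i)))"
    by (intro sum.cong refl) (simp only: f_mid)
  also have "\<dots> = (\<Sum>i\<in>{k<..p}. F (h i))"
    using sum.reindex_bij_betw[OF bij_mid, of "\<lambda>i. F (h i)"] .
  finally show ?thesis .
qed

text \<open>Below row \<open>p\<close> the shift turns the columns \<open>insert q Y\<close> into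
  \<open>insert b Y\<close>, so \<open>q\<close> is lost and \<open>b\<close> gained.\<close>

lemma low_sum:
  fixes F :: "nat \<Rightarrow> int"
  shows "(\<Sum>i\<in>{p<..n}. F (f i)) = (\<Sum>i\<in>{p<..n}. F (h i)) - F q + F b"
proof -
  let ?I = "{i \<in> {p<..n}. q \<le> h i \<and> h i < b}" and ?O = "{i \<in> {p<..n}. \<not> (q \<le> h i \<and> h i < b)}"
  have split: "(\<Sum>i\<in>{p<..n}. G i) = (\<Sum>i\<in>?I. G i) + (\<Sum>i\<in>?O. G i)" for G :: "nat \<Rightarrow> int"
    by (subst sum.union_disjoint[symmetric]) (auto intro: sum.cong)
  have inj: "inj_on h ?I" using kp by (intro inj_on_h) auto
  have "q = h m" "m \<in> ?I" using hm hb pm mn by auto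
  then have "insert q Y = h ` ?I" using q_Y hb by (auto simp: image_iff)
  then have bijI: "bij_betw h ?I (insert q Y)" using inj by (simp add: bij_betw_def)
  have "(\<Sum>i\<in>?I. F (f i)) = (\<Sum>i\<in>?I. F (nxt (insert b Y) (h i)))"
    by (intro sum.cong refl) (simp add: f_low)
  also have "\<dots> = (\<Sum>j\<in>insert q Y. F (nxt (insert b Y) j))"
    using sum.reindex_bij_betw[OF bijI, of "\<lambda>j. F (nxt (insert b Y) j)"] .
  also have "\<dots> = (\<Sum>j\<in>insert b Y. F j)"
    using sum.reindex_bij_betw[OF Cols.bij_betw_nxt, of F] .
  also have "\<dots> = F b + sum F Y" by simp
  finally have 1: "(\<Sum>i\<in>?I. F (f i)) = F b + sum F Y" .
  have "(\<Sum>i\<in>?I. F (h i)) = (\<Sum>j\<in>insert q Y. F j)"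
    using sum.reindex_bij_betw[OF bijI, of F] .
  then have 2: "(\<Sum>i\<in>?I. F (h i)) = F q + sum F Y" by simp
  have 3: "(\<Sum>i\<in>?O. F (f i)) = (\<Sum>i\<in>?O. F (h i))"
    by (intro sum.cong refl) (auto simp: f_low)
  show ?thesis unfolding split[of "\<lambda>i. F (f i)"] split[of "\<lambda>i. F (h i)"] 1 2 3 by simp
qed

lemma pn: "p \<le> n"
  using pm mn by simp

lemmas blocks = sum_blocks[OF less_imp_le[OF kp] pn]

text \<open>\<open>f\<close> and \<open>h(m := b)\<close> both arise from the values of
  \<open>h\<close> by trading one \<open>q\<close> for \<open>b\<close>.\<close>

lemma bij_f: "bij_betw f {1..n} {1..n}"
proof (rule bij_betw_if_sums_eq[OF _ bij])
  fix F :: "nat \<Rightarrow> int"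
  have "(\<Sum>i\<in>{1..k}. F (f i)) = (\<Sum>i\<in>{1..k}. F (h i))"
    by (intro sum.cong refl) (simp add: f_upper)
  then have "(\<Sum>i\<in>{1..n}. F (f i)) = (\<Sum>i\<in>{1..n}. F (h i)) - F q + F b"
    unfolding blocks(1) mid_sum low_sum by simp
  also have "(\<Sum>i\<in>{1..n}. F (h i)) = F (h m) + (\<Sum>i\<in>{1..n} - {m}. F (h i))"
    using k1 kp pm mn by (intro sum.remove) auto
  also have "(\<Sum>i\<in>{1..n} - {m}. F (h i)) = (\<Sum>i\<in>{1..n} - {m}. F ((h(m := b)) i))"
    by (intro sum.cong) auto
  also have "F (h m) + \<dots> - F q + F b = F ((h(m := b)) m) + (\<Sum>i\<in>{1..n} - {m}. F ((h(m := b)) i))"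
    using hm by simp
  also have "\<dots> = (\<Sum>i\<in>{1..n}. F ((h(m := b)) i))"
    using k1 kp pm mn by (intro sum.remove[symmetric]) auto
  finally show "(\<Sum>i\<in>{1..n}. F (f i)) = (\<Sum>i\<in>{1..n}. F ((h(m := b)) i))" .
qed simp

lemma f_k: "f k = q"
  by (simp add: f_upper)

lemma f_Suc_k: "f (Suc k) = leading_col A"
  using f_mid[of k] kp by (simp add: leading_col_A)

lemma f_Suc_k_less: "f (Suc k) < q"
  using f_mid[of k] kp nxt_X[of k] by simp

text \<open>Carries the condition of \<open>nonneg_A\<close> over to \<open>f\<close>. With enclosed
  rows present, row \<open>p\<close> receives the entry of row \<open>p - 1\<close> if that lies on
  the right, and a left entry otherwise.\<close>

lemma f_p: "q < f p \<or> p = Suc k \<longleftrightarrow> p = Suc k \<or> q < h (p - 1)"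
proof (cases "p = Suc k")
  case False
  then have r: "p - 1 \<in> {k<..<p}" and s: "p = Suc (p - 1)" using kp by auto
  show ?thesis
  proof (cases "p - 1 \<in> X")
    case True
    then have "f p < q" using f_mid[of "p - 1"] nxt_X[of "p - 1"] r s by auto
    then show ?thesis using True False by auto
  next
    case F: False
    then have "f p = h (p - 1)" using f_mid[of "p - 1"] r s by auto
    then show ?thesis by auto
  qed
qed auto

lemma f_eq_b: "\<exists>i\<in>{p<..n}. f i = b"
proof -
  have "0 \<le> (\<Sum>i\<in>{p<..n}. of_bool (h i = b) :: int)" by (intro sum_nonneg) simp
  then have "(\<Sum>i\<in>{p<..n}. of_bool (f i = b)) \<noteq> (0::int)"
    using low_sum[of "\<lambda>x. of_bool (x = b)"] hb by simp
  then show ?thesis using sum_of_bool_neq_0_iff[of "{p<..n}" "\<lambda>i. f i = b"] by simp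
qed

text \<open>Row \<open>p\<close> may be added to the enclosed rows since \<open>h p\<close> is on
  the left; then \<open>mid_sum\<close> applies.\<close>

lemma charge_cell_f: "charge_cell n A = (\<Sum>i\<in>{k<..p}. of_bool (q < f i))"
proof -
  have "{k<..p} = insert p {k<..<p}" using kp by auto
  then show ?thesis
    using hp mid_sum[of "\<lambda>x. of_bool (q < x)"] by (simp add: charge_cell_A)
qed

text \<open>The extra 1 is the column \<open>b\<close> that \<open>f\<close> has gained below row
  \<open>p\<close>.\<close>

lemma cpar_f: "cpar n A + 1 = (\<Sum>i\<in>{p<..n}. of_bool (q < f i \<and> f i \<le> b))"
proof -
  have "(\<Sum>i\<in>{p<..n}. of_bool (q < h i \<and> h i \<le> b)) = (\<Sum>i\<in>{p<..n}. of_bool (q < h i \<and> h i < b) :: int)"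
    using h_neq_b kp by (intro sum.cong) (auto simp: le_less)
  then show ?thesis
    using hb low_sum[of "\<lambda>x. of_bool (q < x \<and> x \<le> b)"] by (simp add: cpar_A)
qed

text \<open>Neither \<open>q\<close> nor \<open>b\<close> lies strictly between the leading column
  and \<open>q\<close>, so both sum identities leave the count alone.\<close>

lemma ell_f: "ell n A = (\<Sum>i\<in>{k<..n}. of_bool (f (Suc k) < f i \<and> f i < q))"
  unfolding ell_A f_Suc_k blocks(2)
  using hb mid_sum[of "\<lambda>x. of_bool (leading_col A < x \<and> x < q)"]
    low_sum[of "\<lambda>x. of_bool (leading_col A < x \<and> x < q)"] by simp

text \<open>\<open>recharge\<close> computes its interlacing sets from \<open>f\<close>; this and
  \<open>Y_f\<close> show that they are those of \<open>h\<close>.\<close>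

lemma X_f: "{i \<in> {k<..<p}. f (Suc i) < f k} = X"
proof -
  have "f (Suc i) < q \<longleftrightarrow> h i < q" if i: "i \<in> {k<..<p}" for i
    using f_mid[of i] nxt_X[of i] mid_right[of i] i by auto
  then show ?thesis unfolding f_k by blast
qed

lemma Y_f: "{j \<in> {f k<..<b}. \<exists>i\<in>{p<..n}. f i = j} = Y"
proof -
  have "(\<exists>i\<in>{p<..n}. f i = j) \<longleftrightarrow> (\<exists>i\<in>{p<..n}. h i = j)" if "j \<in> {q<..<b}" for j
    using low_sum[of "\<lambda>x. of_bool (x = j)"] that
    by (simp add: sum_of_bool_neq_0_iff[symmetric])
  then show ?thesis unfolding f_k by blast
qed

lemma recharge_f:
  assumes "i \<in> {1..n}" shows "recharge n f k p b i = h i"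
proof -
  have recharge: "recharge n f k p b i =
    (if i \<le> k then f i
     else if i \<le> p then (if i \<in> insert p X then f (Suc (prv (insert k X) i)) else f (Suc i))
     else if q < f i \<and> f i \<le> b then prv (insert q Y) (f i) else f i)"
    unfolding recharge_def Let_def f_k X_f[unfolded f_k] Y_f[unfolded f_k] ..
  consider "i \<le> k" | "k < i" "i \<le> p" | "p < i" by linarith
  then show ?thesis
  proof cases
    case 1 then show ?thesis unfolding recharge by (simp add: f_upper)
  next
    case 2
    show ?thesis
    proof (cases "i \<in> insert p X")
      case True
      have "prv (insert k X) i \<in> insert k X" "prv (insert k X) i \<in> {k..<p}"
        using Rows.prv_props(1,2)[OF True] 2 kp by auto
      then have "f (Suc (prv (insert k X) i)) = h i"
        using f_mid[of "prv (insert k X) i"] Rows.nxt_prv[OF True] by presburger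
      then show ?thesis unfolding recharge using 2 True by simp
    next
      case False
      then have "f (Suc i) = h i" using 2 f_mid[of i] by auto
      then show ?thesis unfolding recharge using 2 False by auto
    qed
  next
    case 3
    then have i: "i \<in> {p<..n}" using assms by simp
    show ?thesis
    proof (cases "q \<le> h i \<and> h i < b")
      case True
      then have y: "h i \<in> insert q Y" using q_Y i by blast
      then have "f i = nxt (insert b Y) (h i)" using f_low[OF i] True by simp
      moreover from Cols.nxt_props(1,2)[OF y] have
        "q < nxt (insert b Y) (h i)" "nxt (insert b Y) (h i) \<le> b" using True by auto
      ultimately show ?thesis unfolding recharge using 3 kp Cols.prv_nxt[OF y] by simp
    next
      case False
      then have "f i = h i" "\<not> (q < h i \<and> h i \<le> b)"
        using f_low[OF i] h_neq_b[OF assms] by auto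
      then show ?thesis unfolding recharge using 3 kp by auto
    qed
  qed
qed

end

text \<open>Restricted to a set of rows so that inversions can be split over the rows up to
  \<open>k\<close>, from \<open>k + 1\<close> to \<open>p\<close>, and below
  \<open>p\<close>.\<close>

definition inv_on :: "nat set \<Rightarrow> (nat \<Rightarrow> nat) \<Rightarrow> int" where
  "inv_on S f = (\<Sum>i\<in>S. \<Sum>i'\<in>S. of_bool (i < i' \<and> f i' < f i))"

lemma inv_on_union:
  assumes "finite S" "finite T" "\<And>s t. s \<in> S \<Longrightarrow> t \<in> T \<Longrightarrow> s < t"
  shows "inv_on (S \<union> T) f = inv_on S f + inv_on T f + (\<Sum>s\<in>S. \<Sum>t\<in>T. of_bool (f t < f s))"
proof -
  have disj: "S \<inter> T = {}" using assms(3) by blast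
  have 1: "(\<Sum>s\<in>S. \<Sum>t\<in>T. of_bool (s < t \<and> f t < f s) :: int) = (\<Sum>s\<in>S. \<Sum>t\<in>T. of_bool (f t < f s))"
    using assms(3) by (intro sum.cong) auto
  have 2: "(\<Sum>t\<in>T. \<Sum>s\<in>S. of_bool (t < s \<and> f s < f t) :: int) = 0"
    using assms(3) by (intro sum.neutral ballI) (auto dest: less_asym)
  show ?thesis
    unfolding inv_on_def
    by (simp add: sum.union_disjoint[OF assms(1,2) disj] sum.distrib 1 2)
qed

section \<open>The matrix \<open>delta\<close> and the number of inversions\<close>

context one_minus
begin

lemma f_range: "i \<in> {1..n} \<Longrightarrow> f i \<in> {1..n}"
  using bij_betwE[OF bij_f] by blast

lemma closing_erased: "(\<lambda>i j. if i = p \<and> (j = q \<or> j = b) then 0 else A i j) = permmat n h"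
  using h_neq_b[of p] hp k1 kp pm mn by (intro ext) (auto simp: asmat_def permmat_def)

text \<open>Below row \<open>p\<close> the occupied columns from \<open>q\<close> to
  \<open>b\<close> are \<open>insert q Y\<close>: row \<open>m\<close> occupies \<open>q\<close>,
  while column \<open>b\<close> had only the closing 1 in row \<open>p\<close>.\<close>

lemma hdisp_permmat:
  "hdisp (permmat n h) {p<..n} q b = (\<lambda>i j. if p < i then permmat n f i j else permmat n h i j)"
proof (intro ext)
  fix i j
  have S: "{j \<in> {q..b}. \<exists>i\<in>{p<..n}. permmat n h i j \<noteq> 0} = insert q Y"
  proof -
    have "(\<exists>i\<in>{p<..n}. permmat n h i j \<noteq> 0) \<longleftrightarrow> (\<exists>i\<in>{p<..n}. h i = j)" for j
      by (intro bex_cong refl) (auto simp: permmat_def)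
    moreover have "\<exists>i\<in>{p<..n}. h i = q" using hm pm mn by (intro bexI[of _ m]) auto
    moreover have "\<not> (\<exists>i\<in>{p<..n}. h i = b)" using h_neq_b by auto
    ultimately show ?thesis using hb by (auto simp: le_less)
  qed
  \<comment> \<open>Dropping the least column and adding \<open>b\<close> turns the source columns
    into the target columns.\<close>
  have "Min (insert q Y) = q" by (rule Min_eqI) auto
  then have T: "insert q Y - {Min (insert q Y)} \<union> {b} = insert b Y" by auto
  have hd: "hdisp (permmat n h) {p<..n} q b i j =
    (if i \<in> {p<..n} \<and> q \<le> j \<and> j \<le> b
     then (if j \<in> insert b Y then permmat n h i (prv (insert q Y) j) else 0) else permmat n h i j)"
    unfolding hdisp_def Let_def S T prv_def ..
  show "hdisp (permmat n h) {p<..n} q b i j = (if p < i then permmat n f i j else permmat n h i j)"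
  proof (cases "i \<in> {p<..n}")
    case False
    then show ?thesis unfolding hd by (auto simp: permmat_def)
  next
    case i: True
    then have i': "i \<in> {1..n}" by auto
    show ?thesis
    proof (cases "q \<le> h i \<and> h i < b")
      case True
      then have y: "h i \<in> insert q Y" using q_Y i by blast
      have fi: "f i = nxt (insert b Y) (h i)" using f_low_in[OF i True] .
      have fb: "f i \<in> insert b Y" unfolding fi using Cols.nxt_props(1)[OF y] .
      then have fq: "q \<le> f i \<and> f i \<le> b" using hb by auto
      \<comment> \<open>\<open>hdisp\<close> fetches column \<open>j\<close> from its predecessor,
        whereas \<open>f\<close> sends an entry to its successor; the interlacing bijection
        identifies the two.\<close>
      have eq: "prv (insert q Y) j = h i \<longleftrightarrow> j = f i" if "j \<in> insert b Y"
        unfolding fi by (rule Cols.prv_eq_iff[OF y that])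
      consider "q \<le> j \<and> j \<le> b" "j \<in> insert b Y" | "q \<le> j \<and> j \<le> b" "j \<notin> insert b Y"
        | "\<not> (q \<le> j \<and> j \<le> b)" by blast
      then show ?thesis
      proof cases
        case 1
        have "permmat n h i (prv (insert q Y) j) = permmat n f i j"
          by (simp only: permmat_def eq[OF 1(2)])
        then show ?thesis unfolding hd using i 1 by simp
      next
        case 2
        then have "j \<noteq> f i" using fb by blast
        then show ?thesis unfolding hd using i 2 by (auto simp: permmat_def)
      next
        case 3
        then have "j \<noteq> f i" "j \<noteq> h i" using fq True by auto
        then show ?thesis unfolding hd using i 3 by (auto simp: permmat_def)
      qed
    next
      case False
      then have fi: "f i = h i" by (rule f_low_out[OF i])
      have nb: "h i \<noteq> b" using h_neq_b[OF i'] .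
      show ?thesis
      proof (cases "q \<le> j \<and> j \<le> b")
        case True
        then have "j \<noteq> h i" using False nb by auto
        moreover have "prv (insert q Y) j \<noteq> h i" if "j \<in> insert b Y"
          using Cols.prv_props(1)[OF that] False hb by auto
        ultimately show ?thesis unfolding hd using i True fi by (auto simp: permmat_def)
      next
        case False
        then show ?thesis unfolding hd using i fi by (auto simp: permmat_def)
      qed
    qed
  qed
qed

text \<open>On the left, row \<open>k\<close> is empty, its 1 being in column \<open>q\<close>, and
  row \<open>p\<close> is occupied by \<open>h p\<close>. So the occupied rows are
  \<open>insert p X\<close> and the target rows \<open>insert k X\<close>. Source rows are at most
  \<open>p\<close>, where \<open>M\<close> still agrees with \<open>h\<close>.\<close>

lemma vdisp_permmat:
  assumes M: "M = (\<lambda>i j. if p < i then permmat n f i j else permmat n h i j)"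
  shows "vdisp M k p {1..<q} i j =
    (if k \<le> i \<and> i \<le> p \<and> 1 \<le> j \<and> j < q
     then (if i \<in> insert k X then permmat n h (nxt (insert p X) i) j else 0) else M i j)"
proof -
  have "h i < q \<longleftrightarrow> (\<exists>j\<in>{1..<q}. M i j \<noteq> 0)" if "i \<in> {k..p}" for i
    using that k1 pm mn h_range[of i] by (auto simp: permmat_def M)
  then have "{i \<in> {k..p}. \<exists>j\<in>{1..<q}. M i j \<noteq> 0} = {i \<in> {k..p}. h i < q}" by blast
  also have "\<dots> = insert p X" using hp kp by (auto simp: le_less)
  finally have S: "{i \<in> {k..p}. \<exists>j\<in>{1..<q}. M i j \<noteq> 0} = insert p X" .
  have "Max (insert p X) = p" by (rule Max_eqI) auto
  then have T: "{k} \<union> (insert p X - {Max (insert p X)}) = insert k X" by auto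
  have v: "vdisp M k p {1..<q} i j =
    (if k \<le> i \<and> i \<le> p \<and> j \<in> {1..<q}
     then (if i \<in> insert k X then M (nxt (insert p X) i) j else 0) else M i j)"
    unfolding vdisp_def Let_def S T nxt_def ..
  have "M (nxt (insert p X) i) j = permmat n h (nxt (insert p X) i) j" if "i \<in> insert k X"
    using nxt_X[OF that] by (simp add: M)
  then show ?thesis unfolding v by auto
qed

lemma f_mid_neq_q: "i \<in> {k<..p} \<Longrightarrow> f i \<noteq> q \<and> h i \<noteq> q"
  using inj_onD[OF bij_betw_imp_inj_on[OF bij_f], of i k] f_k h_eq_q_iff[of i] k1 kp pm mn by auto

lemma delta_A: "delta n A = permmat n f"
proof (intro ext)
  fix i j
  define M where "M = (\<lambda>i j. if p < i then permmat n f i j else permmat n h i j)"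
  define V where "V = vdisp M k p {1..<q}"
  have V: "V i j =
    (if k \<le> i \<and> i \<le> p \<and> 1 \<le> j \<and> j < q
     then (if i \<in> insert k X then permmat n h (nxt (insert p X) i) j else 0) else M i j)" for i j
    unfolding V_def by (rule vdisp_permmat[OF M_def])
  have d: "delta n A i j =
    (if 1 \<le> j \<and> j < q \<and> k \<le> i \<and> i \<le> p then (if i = k then 0 else V (i - 1) j)
     else if q < j \<and> j \<le> n \<and> Suc k \<le> i \<and> i \<le> p then (if i = Suc k then 0 else V (i - 1) j)
     else V i j)"
    unfolding delta_def Let_def pars_A closing_erased hdisp_permmat V_def M_def ..
  have p1: "i \<in> {1..n}" if "k \<le> i" "i \<le> p" for i using that k1 pm mn by auto
  consider (up) "i \<le> k" | (mid) "k < i" "i \<le> p" | (low) "p < i" by linarith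
  then show "delta n A i j = permmat n f i j"
  proof cases
    case up
    show ?thesis
    proof (cases "i = k")
      case True
      then show ?thesis unfolding d V M_def using f_k kp by (auto simp: permmat_def)
    next
      case False
      then show ?thesis unfolding d V M_def using up kp f_upper[of i] by (auto simp: permmat_def)
    qed
  next
    case low
    then show ?thesis unfolding d V M_def using kp by auto
  next
    case mid
    \<comment> \<open>Lowering moves row \<open>t\<close> into row \<open>i\<close>; for
      \<open>i = k + 1\<close> this is the opening row.\<close>
    define t where "t = i - 1"
    have t: "i = Suc t" "t \<in> {k..<p}" using mid by (auto simp: t_def)
    have i': "i \<in> {1..n}" "t \<in> {1..n}" using p1[of i] p1[of t] mid t by auto
    have fi: "f i = h (if t \<in> insert k X then nxt (insert p X) t else t)" using f_mid t by blast
    consider (left) "1 \<le> j" "j < q" | (right) "q < j" "j \<le> n" | (other) "j = 0 \<or> j = q \<or> n < j"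
      by linarith
    then show ?thesis
    proof cases
      case left
      have "delta n A i j = V t j" unfolding d using left mid by (simp add: t_def)
      also have "\<dots> = (if t \<in> insert k X then permmat n h (nxt (insert p X) t) j else 0)"
        unfolding V using left t by simp
      also have "\<dots> = permmat n f i j"
      proof (cases "t \<in> insert k X")
        case True
        then show ?thesis using fi nxt_X[OF True] p1[of "nxt (insert p X) t"] i'
          by (simp add: permmat_def)
      next
        case False
        then have "q < h t" using mid_right[of t] t by auto
        then show ?thesis using False fi left by (simp add: permmat_def)
      qed
      finally show ?thesis .
    next
      case right
      show ?thesis
      proof (cases "t = k")
        \<comment> \<open>\<open>delta\<close> clears the right part of row \<open>k + 1\<close>, in
          agreement with \<open>f\<close>, whose entry there is on the left.\<close>
        case True
        then have "f i < q" using f_Suc_k_less t by simp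
        then show ?thesis unfolding d using True t right mid by (simp add: permmat_def)
      next
        case False
        then have "delta n A i j = V t j" unfolding d using right mid by (auto simp: t_def)
        also have "\<dots> = permmat n h t j" unfolding V M_def using right t by auto
        also have "\<dots> = permmat n f i j"
        proof (cases "t \<in> X")
          case True
          then have "f i < q" "h t < q" using fi nxt_X[of t] by auto
          then show ?thesis using right by (simp add: permmat_def)
        next
          case F: False
          then have "f i = h t" using fi False by auto
          then show ?thesis using i' by (simp add: permmat_def)
        qed
        finally show ?thesis .
      qed
    next
      \<comment> \<open>Column \<open>q\<close> is not lowered, but in rows \<open>k + 1\<close> to
        \<open>p\<close> it has no entry before or after.\<close>
      case other
      then have "permmat n h i j = 0" "permmat n f i j = 0"
        using h_range[OF i'(1)] f_range[OF i'(1)] f_mid_neq_q[of i] mid by (auto simp: permmat_def)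
      moreover have nj: "\<not> (1 \<le> j \<and> j < q)" "\<not> (q < j \<and> j \<le> n)"
        using other h_range[OF p1[OF order_refl]] kp by auto
      moreover have "delta n A i j = V i j" unfolding d using nj by auto
      moreover have "V i j = M i j" unfolding V using nj by auto
      ultimately show ?thesis using mid by (simp add: M_def)
    qed
  qed
qed

text \<open>\<open>row_sum\<close> is applied to the lower row of each pair and then to the upper
  one. The two extra sums are the corrections by the closing 1 and the -1, with row \<open>p\<close>
  as the lower and as the upper row respectively.\<close>

lemma inversions_A:
  "inversions n A = inv_on {1..n} h
    + (\<Sum>i\<in>{1..<p}. of_bool (b < h i) - of_bool (q < h i))
    + (\<Sum>i\<in>{p<..n}. of_bool (h i < b) - of_bool (h i < q))"
proof -
  \<comment> \<open>\<open>G k' j\<close> is the sum of the entries of row \<open>k'\<close>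
    strictly left of column \<open>j\<close>.\<close>
  define G where "G = (\<lambda>k j. of_bool (h k < j)
    + (if k = p then of_bool (b < j) - of_bool (q < j) else 0) :: int)"
  have rng: "h i \<in> {1..n}" if "i \<in> {1..n}" for i using h_range that .
  have qr: "q \<in> {1..n}" using h_range[of k] k1 kp pm mn by auto
  have G: "(\<Sum>l\<in>{1..n}. A k' l * of_bool (l < j)) = G k' j" if "k' \<in> {1..n}" for k' j
    using row_sum[OF that, of "{1..n}" "\<lambda>l. of_bool (l < j)"] rng[OF that] qr b_range
    by (simp add: G_def)
  have H: "(\<Sum>j\<in>{1..n}. A i j * G k' j) = G k' (h i) + (if i = p then G k' b - G k' q else 0)"
    if "i \<in> {1..n}" for i k'
    using row_sum[OF that, of "{1..n}" "G k'"] rng[OF that] qr b_range by simp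
  have "inversions n A = (\<Sum>i\<in>{1..n}. \<Sum>k'\<in>{1..n}. \<Sum>j\<in>{1..n}. \<Sum>l\<in>{1..n}.
      if i < k' \<and> l < j then A i j * A k' l else 0)"
    unfolding inversions_def by (intro sum.cong refl sum.swap)
  also have "\<dots> = (\<Sum>i\<in>{1..n}. \<Sum>k'\<in>{1..n}. of_bool (i < k') *
      (\<Sum>j\<in>{1..n}. A i j * (\<Sum>l\<in>{1..n}. A k' l * of_bool (l < j))))"
    unfolding sum_distrib_left by (intro sum.cong refl) auto
  also have "\<dots> = (\<Sum>i\<in>{1..n}. \<Sum>k'\<in>{1..n}. of_bool (i < k') *
      (G k' (h i) + (if i = p then G k' b - G k' q else 0)))"
    by (intro sum.cong refl) (simp only: G H cong: sum.cong)
  also have "\<dots> = (\<Sum>i\<in>{1..n}. \<Sum>k'\<in>{1..n}. of_bool (i < k' \<and> h k' < h i)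
     + (if k' = p then of_bool (i < p) * (of_bool (b < h i) - of_bool (q < h i)) else 0)
     + (if i = p then of_bool (p < k') * (of_bool (h k' < b) - of_bool (h k' < q)) else 0))"
    by (intro sum.cong refl) (auto simp: G_def)
  also have "\<dots> = inv_on {1..n} h
     + (\<Sum>i\<in>{1..n}. of_bool (i < p) * (of_bool (b < h i) - of_bool (q < h i)))
     + (\<Sum>k'\<in>{1..n}. of_bool (p < k') * (of_bool (h k' < b) - of_bool (h k' < q)))"
  proof -
    have "(\<Sum>i\<in>{1..n}. \<Sum>k'\<in>{1..n}. if i = p then W k' else 0) = (\<Sum>k'\<in>{1..n}. W k')" for W :: "nat \<Rightarrow> int"
      using k1 kp pm mn by (subst sum.swap) simp
    then show ?thesis using k1 kp pm mn by (simp add: sum.distrib inv_on_def)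
  qed
  also have "(\<Sum>i\<in>{1..n}. of_bool (i < p) * (of_bool (b < h i) - of_bool (q < h i)))
     = (\<Sum>i\<in>{1..<p}. of_bool (b < h i) - of_bool (q < h i) :: int)"
    using pm mn by (intro sum.mono_neutral_cong_right) auto
  also have "(\<Sum>k'\<in>{1..n}. of_bool (p < k') * (of_bool (h k' < b) - of_bool (h k' < q)))
     = (\<Sum>k'\<in>{p<..n}. of_bool (h k' < b) - of_bool (h k' < q) :: int)"
    by (intro sum.mono_neutral_cong_right) auto
  finally show ?thesis .
qed

text \<open>Shifted entries end up after \<open>q\<close> and at most at \<open>b\<close>, in the
  same order; every other entry below row \<open>p\<close> is left of \<open>q\<close> or right of
  \<open>b\<close> and stays there.\<close>

lemma inv_on_low: "inv_on {p<..n} f = inv_on {p<..n} h"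
proof -
  have "f i' < f i \<longleftrightarrow> h i' < h i" if i: "i \<in> {p<..n}" and i': "i' \<in> {p<..n}" for i i'
  proof -
    have r: "q < f z \<and> f z \<le> b" if z: "z \<in> {p<..n}" "q \<le> h z \<and> h z < b" for z
      using f_low[OF z(1)] z Cols.nxt_props(1,2)[OF q_Y[OF z(1)]] by auto
    have nb: "h z \<noteq> b" if "z \<in> {p<..n}" for z using h_neq_b[of z] that by auto
    show ?thesis
    proof (cases "(q \<le> h i \<and> h i < b) \<and> (q \<le> h i' \<and> h i' < b)")
      case True
      then show ?thesis
        using f_low[OF i] f_low[OF i'] Cols.nxt_less_iff[OF q_Y[OF i'] q_Y[OF i]] by simp
    next
      case False
      then show ?thesis
        using f_low[OF i] f_low[OF i'] r[OF i] r[OF i'] nb[OF i] nb[OF i'] by (auto simp: not_less not_le)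
    qed
  qed
  then show ?thesis unfolding inv_on_def by (intro sum.cong refl) simp
qed

text \<open>Reindexing by \<open>\<alpha>\<close> lists the same columns on both sides; only the
  positions compared differ, \<open>\<alpha> i\<close> for \<open>h\<close> and \<open>i\<close> for
  \<open>f\<close>. The outcome changes only for a right row paired with left ones, and there each
  right row has exactly one inversion more in \<open>h\<close>.\<close>

lemma inv_on_mid: "inv_on {k<..p} h = inv_on {k<..p} f + charge_cell n A"
proof -
  let ?R = "{k<..<p} - X"
  let ?L = "insert k X"
  let ?N = "nxt (insert p X)"
  define \<alpha> where "\<alpha> = (\<lambda>i. if i \<in> ?L then ?N i else i)"
  have bij\<alpha>: "bij_betw \<alpha> {k..<p} {k<..p}" unfolding \<alpha>_def by (rule bij_mid)
  have fa: "f (Suc i) = h (\<alpha> i)" if "i \<in> {k..<p}" for i using f_mid[OF that] by (simp only: \<alpha>_def)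
  have kp_split: "{k..<p} = ?L \<union> ?R" using kp by auto
  have split2: "(\<Sum>i\<in>{k..<p}. \<Sum>i'\<in>{k..<p}. W i i') =
      (\<Sum>i\<in>?L. \<Sum>i'\<in>?L. W i i') + (\<Sum>i\<in>?L. \<Sum>i'\<in>?R. W i i')
    + (\<Sum>i\<in>?R. \<Sum>i'\<in>?L. W i i') + (\<Sum>i\<in>?R. \<Sum>i'\<in>?R. W i i')" for W :: "nat \<Rightarrow> nat \<Rightarrow> int"
  proof -
    have 1: "(\<Sum>i\<in>{k..<p}. V i) = (\<Sum>i\<in>?L. V i) + (\<Sum>i\<in>?R. V i)" for V :: "nat \<Rightarrow> int"
      unfolding kp_split by (rule sum.union_disjoint) auto
    show ?thesis unfolding 1 by (simp add: sum.distrib)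
  qed
  have L: "h (\<alpha> i) < q" "\<alpha> i = ?N i" if "i \<in> ?L" for i using nxt_X[OF that] that by (auto simp: \<alpha>_def)
  have R: "q < h (\<alpha> i)" "\<alpha> i = i" if "i \<in> ?R" for i using mid_right[of i] that by (auto simp: \<alpha>_def)
  have LR: "\<not> h (\<alpha> i') < h (\<alpha> i)" if "i \<in> ?L" "i' \<in> ?R" for i i'
    using L(1)[OF that(1)] R(1)[OF that(2)] by linarith
  have "inv_on {k<..p} h = (\<Sum>i\<in>{k..<p}. \<Sum>i'\<in>{k..<p}. of_bool (\<alpha> i < \<alpha> i' \<and> h (\<alpha> i') < h (\<alpha> i)))"
    unfolding inv_on_def
    by (simp only: sum.reindex_bij_betw[OF bij\<alpha>, symmetric])
  moreover have "inv_on {k<..p} f = (\<Sum>i\<in>{k..<p}. \<Sum>i'\<in>{k..<p}. of_bool (i < i' \<and> h (\<alpha> i') < h (\<alpha> i)))"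
  proof -
    have "bij_betw Suc {k..<p} {k<..p}"
      by (metis atLeastLessThanSuc_atLeastAtMost atLeastSucAtMost_greaterThanAtMost bij_betw_imageI
          image_Suc_atLeastLessThan inj_Suc inj_on_subset subset_UNIV)
    note S = sum.reindex_bij_betw[OF this, symmetric]
    show ?thesis
      unfolding inv_on_def S by (intro sum.cong refl) (simp only: fa Suc_less_eq)
  qed
  moreover have "(\<Sum>i\<in>?L. \<Sum>i'\<in>?L. of_bool (\<alpha> i < \<alpha> i' \<and> h (\<alpha> i') < h (\<alpha> i)) :: int)
      = (\<Sum>i\<in>?L. \<Sum>i'\<in>?L. of_bool (i < i' \<and> h (\<alpha> i') < h (\<alpha> i)))"
    by (intro sum.cong refl) (simp only: L(2) Rows.nxt_less_iff)
  moreover have "(\<Sum>i\<in>?L. \<Sum>i'\<in>?R. of_bool (\<alpha> i < \<alpha> i' \<and> h (\<alpha> i') < h (\<alpha> i)) :: int) = 0"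
    "(\<Sum>i\<in>?L. \<Sum>i'\<in>?R. of_bool (i < i' \<and> h (\<alpha> i') < h (\<alpha> i)) :: int) = 0"
    by (intro sum.neutral ballI; simp only: LR simp_thms of_bool_eq)+
  moreover have "(\<Sum>i\<in>?R. \<Sum>i'\<in>?R. of_bool (\<alpha> i < \<alpha> i' \<and> h (\<alpha> i') < h (\<alpha> i)) :: int)
      = (\<Sum>i\<in>?R. \<Sum>i'\<in>?R. of_bool (i < i' \<and> h (\<alpha> i') < h (\<alpha> i)))"
    by (intro sum.cong refl) (simp only: R(2))
  moreover have "(\<Sum>i\<in>?R. \<Sum>i'\<in>?L. of_bool (\<alpha> i < \<alpha> i' \<and> h (\<alpha> i') < h (\<alpha> i)) :: int)
      = (\<Sum>i\<in>?R. \<Sum>i'\<in>?L. of_bool (i < i' \<and> h (\<alpha> i') < h (\<alpha> i))) + charge_cell n A"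
  proof -
    \<comment> \<open>For a right row \<open>i\<close>, the later left positions are counted in
      \<open>insert p X\<close> for \<open>h\<close> and in \<open>insert k X\<close> for
      \<open>f\<close>. The end \<open>p\<close> always counts and \<open>k\<close> never
      does.\<close>
    have "(\<Sum>i'\<in>?L. of_bool (\<alpha> i < \<alpha> i' \<and> h (\<alpha> i') < h (\<alpha> i)) :: int)
      = (\<Sum>i'\<in>?L. of_bool (i < i' \<and> h (\<alpha> i') < h (\<alpha> i))) + 1" if i: "i \<in> ?R" for i
    proof -
      have lt: "h (\<alpha> i') < h (\<alpha> i)" if "i' \<in> ?L" for i' using L(1)[OF that] R(1)[OF i] by linarith
      have "(\<Sum>i'\<in>?L. of_bool (\<alpha> i < \<alpha> i' \<and> h (\<alpha> i') < h (\<alpha> i)) :: int)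
        = (\<Sum>i'\<in>?L. of_bool (i < ?N i'))"
        by (intro sum.cong refl arg_cong[where f = of_bool])
          (use lt in \<open>simp only: L(2)[symmetric] simp_thms\<close>, simp only: R(2)[OF i])
      also have "\<dots> = (\<Sum>i'\<in>insert p X. of_bool (i < i'))"
        using sum.reindex_bij_betw[OF Rows.bij_betw_nxt, of "\<lambda>i'. of_bool (i < i')"] .
      also have "\<dots> = 1 + (\<Sum>i'\<in>X. of_bool (i < i'))" using i by (subst sum.insert) auto
      also have "(\<Sum>i'\<in>X. of_bool (i < i') :: int) = (\<Sum>i'\<in>?L. of_bool (i < i'))"
        using i by (subst sum.insert) auto
      also have "\<dots> = (\<Sum>i'\<in>?L. of_bool (i < i' \<and> h (\<alpha> i') < h (\<alpha> i)))"
        by (intro sum.cong refl) (simp only: lt simp_thms)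
      finally show ?thesis by simp
    qed
    moreover have "charge_cell n A = (\<Sum>i\<in>?R. 1)"
    proof -
      have "{i \<in> {k<..<p}. q < h i} = ?R" using mid_right by auto
      then show ?thesis unfolding charge_cell_A by (simp add: of_bool_def sum.If_cases Int_def)
    qed
    ultimately show ?thesis by (simp only: sum.distrib cong: sum.cong)
  qed
  ultimately show ?thesis unfolding split2 by linarith
qed

text \<open>The change of the cross terms with the lower block matches the correction for rows above
  \<open>p\<close> in \<open>inversions_A\<close>. The middle block yields the charge, and the
  correction for rows below \<open>p\<close> yields \<open>cpar n A + 1\<close>.\<close>

lemma inversions_f: "inversions n A = inv_on {1..n} f + charge_cell n A + cpar n A + 1"
proof -
  have blocks: "{1..n} = {1..p} \<union> {p<..n}" "{1..p} = {1..k} \<union> {k<..p}" using k1 kp pm mn by auto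
  have inv: "inv_on {1..n} g = inv_on {1..k} g + inv_on {k<..p} g
      + (\<Sum>s\<in>{1..k}. \<Sum>t\<in>{k<..p}. of_bool (g t < g s))
      + inv_on {p<..n} g + (\<Sum>s\<in>{1..p}. \<Sum>t\<in>{p<..n}. of_bool (g t < g s))" for g
  proof -
    have "inv_on {1..p} g = inv_on {1..k} g + inv_on {k<..p} g
      + (\<Sum>s\<in>{1..k}. \<Sum>t\<in>{k<..p}. of_bool (g t < g s))"
      unfolding blocks(2) by (rule inv_on_union) auto
    moreover have "inv_on {1..n} g = inv_on {1..p} g + inv_on {p<..n} g
       + (\<Sum>s\<in>{1..p}. \<Sum>t\<in>{p<..n}. of_bool (g t < g s))"
      unfolding blocks(1) by (rule inv_on_union) auto
    ultimately show ?thesis by simp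
  qed
  have up: "inv_on {1..k} f = inv_on {1..k} h"
    unfolding inv_on_def by (intro sum.cong refl) (simp add: f_upper)
  have upmid: "(\<Sum>s\<in>{1..k}. \<Sum>t\<in>{k<..p}. of_bool (f t < f s) :: int)
      = (\<Sum>s\<in>{1..k}. \<Sum>t\<in>{k<..p}. of_bool (h t < h s))"
  proof (rule sum.cong[OF refl])
    fix s assume "s \<in> {1..k}"
    then show "(\<Sum>t\<in>{k<..p}. of_bool (f t < f s) :: int) = (\<Sum>t\<in>{k<..p}. of_bool (h t < h s))"
      using mid_sum[of "\<lambda>x. of_bool (x < h s)"] f_upper[of s] by simp
  qed
  \<comment> \<open>\<open>W u\<close> counts the entries of \<open>f\<close> below row
    \<open>p\<close> that are less than \<open>u\<close>, expressed through \<open>h\<close> by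
    \<open>low_sum\<close>.\<close>
  define W where "W = (\<lambda>u. (\<Sum>t\<in>{p<..n}. of_bool (h t < u)) - of_bool (q < u) + of_bool (b < u) :: int)"
  have "(\<Sum>s\<in>{1..p}. \<Sum>t\<in>{p<..n}. of_bool (f t < f s)) = (\<Sum>s\<in>{1..p}. W (f s))"
    unfolding W_def by (rule sum.cong[OF refl]) (rule low_sum)
  also have "\<dots> = (\<Sum>s\<in>{1..k}. W (f s)) + (\<Sum>s\<in>{k<..p}. W (f s))"
    unfolding blocks(2) by (rule sum.union_disjoint) auto
  also have "\<dots> = (\<Sum>s\<in>{1..k}. W (h s)) + (\<Sum>s\<in>{k<..p}. W (h s))"
    unfolding mid_sum by (intro arg_cong2[where f = "(+)"] sum.cong refl) (simp add: f_upper)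
  also have "\<dots> = (\<Sum>s\<in>{1..p}. W (h s))"
    unfolding blocks(2) by (rule sum.union_disjoint[symmetric]) auto
  also have "\<dots> = (\<Sum>s\<in>{1..p}. \<Sum>t\<in>{p<..n}. of_bool (h t < h s))
      + (\<Sum>s\<in>{1..p}. of_bool (b < h s) - of_bool (q < h s))"
    unfolding W_def by (simp add: sum.distrib sum_subtractf)
  also have "(\<Sum>s\<in>{1..p}. of_bool (b < h s) - of_bool (q < h s) :: int)
      = (\<Sum>s\<in>{1..<p}. of_bool (b < h s) - of_bool (q < h s))"
    using hp hb k1 kp by (intro sum.mono_neutral_right) (auto simp: le_less)
  finally have cross: "(\<Sum>s\<in>{1..p}. \<Sum>t\<in>{p<..n}. of_bool (f t < f s) :: int) =
      (\<Sum>s\<in>{1..p}. \<Sum>t\<in>{p<..n}. of_bool (h t < h s))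
      + (\<Sum>s\<in>{1..<p}. of_bool (b < h s) - of_bool (q < h s))" .
  \<comment> \<open>The difference counts columns from \<open>q\<close> to before \<open>b\<close>;
    below \<open>p\<close>, column \<open>q\<close> occurs only in row \<open>m\<close>.\<close>
  have "(\<Sum>i\<in>{p<..n}. of_bool (h i < b) - of_bool (h i < q) :: int)
      = (\<Sum>i\<in>{p<..n}. of_bool (q < h i \<and> h i < b) + of_bool (i = m))"
  proof (intro sum.cong refl)
    fix i assume "i \<in> {p<..n}"
    then have "h i = q \<longleftrightarrow> i = m" using h_eq_q_iff[of i] k1 kp by auto
    then show "of_bool (h i < b) - of_bool (h i < q) = (of_bool (q < h i \<and> h i < b) + of_bool (i = m) :: int)"
      using hb by auto
  qed
  also have "\<dots> = cpar n A + 1"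
    using pm mn by (simp add: sum.distrib cpar_A of_bool_def)
  finally show ?thesis
    unfolding inversions_A inv[of h] inv[of f] up upmid cross inv_on_low inv_on_mid by simp
qed

end

section \<open>Recharging\<close>

text \<open>A count growing by steps of at most 1 reaches every value from 1 to its maximum, at an
  index where it increases and \<open>P\<close> therefore holds.\<close>

lemma count_attained:
  fixes E :: int and k N :: nat
  assumes "1 \<le> E" "E \<le> (\<Sum>i\<in>{k<..N}. of_bool (P i))"
  shows "\<exists>p\<in>{k<..N}. P p \<and> (\<Sum>i\<in>{k<..p}. of_bool (P i)) = E"
  using assms(2)
proof (induction N)
  case 0
  then show ?case using assms(1) by simp
next
  case (Suc N)
  show ?case
  proof (cases "E \<le> (\<Sum>i\<in>{k<..N}. of_bool (P i))")
    case True
    then show ?thesis using Suc.IH by (metis greaterThanAtMost_iff le_SucI)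
  next
    case False
    then have "k \<le> N" using Suc.prems assms(1) by (cases "k \<le> N") auto
    then have "{k<..Suc N} = insert (Suc N) {k<..N}" by auto
    then have s: "(\<Sum>i\<in>{k<..Suc N}. of_bool (P i)) = of_bool (P (Suc N)) + (\<Sum>i\<in>{k<..N}. of_bool (P i) :: int)"
      by simp
    then have "P (Suc N)" "(\<Sum>i\<in>{k<..Suc N}. of_bool (P i)) = E"
      using False Suc.prems by (cases "P (Suc N)"; simp)+
    then show ?thesis using \<open>k \<le> N\<close> by (intro bexI[of _ "Suc N"]) auto
  qed
qed

lemma count_strict:
  fixes k p p' :: nat
  assumes "k \<le> p" "p < p'" "P p'"
  shows "(\<Sum>i\<in>{k<..p}. of_bool (P i)) < (\<Sum>i\<in>{k<..p'}. of_bool (P i) :: int)"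
proof -
  have "{k<..p'} = {k<..p} \<union> {p<..p'}" using assms by auto
  then have "(\<Sum>i\<in>{k<..p'}. of_bool (P i)) = (\<Sum>i\<in>{k<..p}. of_bool (P i)) + (\<Sum>i\<in>{p<..p'}. of_bool (P i) :: int)"
    by (simp only:) (rule sum.union_disjoint, auto)
  moreover have "(1::int) \<le> (\<Sum>i\<in>{p<..p'}. of_bool (P i))"
    using member_le_sum[of p' "{p<..p'}" "\<lambda>i. of_bool (P i) :: int"] assms by auto
  ultimately show ?thesis by linarith
qed

text \<open>The larger index is past \<open>k + 1\<close>, so it satisfies \<open>P\<close> and the
  count has increased there. This recovers \<open>p\<close> from \<open>E\<close> and
  \<open>b\<close> from \<open>c\<close>; the alternative \<open>Suc k\<close> covers the closing
  row of neutral matrices.\<close>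

lemma count_inj:
  fixes k p p' :: nat
  assumes "k < p" "k < p'" "p = Suc k \<or> P p" "p' = Suc k \<or> P p'"
    "(\<Sum>i\<in>{k<..p}. of_bool (P i)) = (\<Sum>i\<in>{k<..p'}. of_bool (P i) :: int)"
  shows "p = p'"
proof (rule linorder_cases[of p p'])
  assume "p < p'"
  then have "P p'" using assms by auto
  then show ?thesis using count_strict[of k p p' P] assms \<open>p < p'\<close> by simp
next
  assume "p' < p"
  then have "P p" using assms by auto
  then show ?thesis using count_strict[of k p' p P] assms \<open>p' < p\<close> by simp
qed

text \<open>Turns a count over rows into one over columns, so that the counting lemmas can also
  locate \<open>b\<close>.\<close>

lemma count_image:
  fixes f :: "nat \<Rightarrow> nat"
  assumes "inj_on f Z" "finite Z"
  shows "(\<Sum>i\<in>Z. of_bool (q < f i \<and> f i \<le> b)) = (\<Sum>j\<in>{q<..b}. of_bool (j \<in> f ` Z) :: int)"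
proof -
  let ?Z = "{i \<in> Z. q < f i \<and> f i \<le> b}"
  have "inj_on f ?Z" using assms(1) by (rule inj_on_subset) auto
  then have "card (f ` ?Z) = card ?Z" by (rule card_image)
  moreover have "f ` ?Z = {j \<in> {q<..b}. j \<in> f ` Z}" by auto
  ultimately have "card ?Z = card {j \<in> {q<..b}. j \<in> f ` Z}" by simp
  then show ?thesis using assms(2) by (simp add: of_bool_def sum.If_cases Int_def)
qed

text \<open>Counterpart of \<open>one_minus\<close>: a permutation with a descent at
  \<open>k\<close>, a row \<open>p\<close>, and a value \<open>b\<close> right of \<open>f k\<close>
  taken below \<open>p\<close>. The lemmas mirror the earlier ones with \<open>nxt\<close> and
  \<open>prv\<close> exchanged.\<close>

locale discharged =
  fixes n :: nat and f :: "nat \<Rightarrow> nat" and k p b :: nat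
  assumes bij: "bij_betw f {1..n} {1..n}" and k1: "1 \<le> k" and kp: "k < p" and pn: "p \<le> n"
    and fk: "f (Suc k) < f k" and fb: "f k < b" and bZ: "b \<in> f ` {p<..n}"
begin

abbreviation "q \<equiv> f k"
abbreviation "X \<equiv> {i \<in> {k<..<p}. f (Suc i) < q}"
abbreviation "Y \<equiv> {j \<in> {q<..<b}. \<exists>i\<in>{p<..n}. f i = j}"
abbreviation "h \<equiv> recharge n f k p b"

sublocale Rows: interlacing X k p
  by unfold_locales (use kp in auto)

sublocale Cols: interlacing Y q b
  by unfold_locales (use fb in auto)

lemma h_upper: "i \<le> k \<Longrightarrow> h i = f i"
  by (simp add: recharge_def)

lemma h_mid: "i \<in> {k<..p} \<Longrightarrow>
    h i = f (Suc (if i \<in> insert p X then prv (insert k X) i else i))"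
  by (auto simp: recharge_def Let_def)

lemma h_low: "i \<in> {p<..n} \<Longrightarrow>
    h i = (if q < f i \<and> f i \<le> b then prv (insert q Y) (f i) else f i)"
  using kp by (auto simp: recharge_def Let_def)

lemma h_low_in: "i \<in> {p<..n} \<Longrightarrow> q < f i \<and> f i \<le> b \<Longrightarrow> h i = prv (insert q Y) (f i)"
  by (simp only: h_low if_True simp_thms)

lemma h_low_out: "i \<in> {p<..n} \<Longrightarrow> \<not> (q < f i \<and> f i \<le> b) \<Longrightarrow> h i = f i"
  by (simp only: h_low if_False)

lemma b_Y: "i \<in> {p<..n} \<Longrightarrow> q < f i \<Longrightarrow> f i \<le> b \<Longrightarrow> f i \<in> insert b Y"
  by (auto simp: le_less)

lemma prv_X: "i \<in> insert p X \<Longrightarrow>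
    prv (insert k X) i \<in> {k..<p} \<and> f (Suc (prv (insert k X) i)) < q"
  using Rows.prv_props(1)[of i] fk kp by auto

lemma inj_f: "i \<in> {1..n} \<Longrightarrow> i' \<in> {1..n} \<Longrightarrow> f i = f i' \<Longrightarrow> i = i'"
  using inj_onD[OF bij_betw_imp_inj_on[OF bij]] by blast

lemma bij_mid: "bij_betw (\<lambda>i. if i \<in> insert p X then prv (insert k X) i else i) {k<..p} {k..<p}"
proof -
  let ?a = "\<lambda>i. if i \<in> insert p X then prv (insert k X) i else i"
  have "bij_betw ?a (insert p X) (insert k X)"
    using Rows.bij_betw_prv by (rule bij_betw_cong[THEN iffD1, rotated]) simp
  moreover have "bij_betw ?a ({k<..<p} - X) ({k<..<p} - X)"
    by (rule bij_betw_cong[THEN iffD1, rotated, OF bij_betw_id]) auto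
  ultimately have "bij_betw ?a (insert p X \<union> ({k<..<p} - X)) (insert k X \<union> ({k<..<p} - X))"
    by (rule bij_betw_combine) auto
  moreover have "insert k X \<union> ({k<..<p} - X) = {k..<p}" "insert p X \<union> ({k<..<p} - X) = {k<..p}"
    using kp by auto
  ultimately show ?thesis by simp
qed

lemma mid_sum:
  fixes F :: "nat \<Rightarrow> int"
  shows "(\<Sum>i\<in>{k<..p}. F (h i)) = (\<Sum>i\<in>{k<..p}. F (f i))"
proof -
  have "(\<Sum>i\<in>{k<..p}. F (h i)) =
      (\<Sum>i\<in>{k<..p}. F (f (Suc (if i \<in> insert p X then prv (insert k X) i else i))))"
    by (intro sum.cong refl) (simp only: h_mid)
  also have "\<dots> = (\<Sum>i\<in>{k..<p}. F (f (Suc i)))"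
    using sum.reindex_bij_betw[OF bij_mid, of "\<lambda>i. F (f (Suc i))"] .
  also have "\<dots> = (\<Sum>i\<in>{k<..p}. F (f i))"
    using sum.shift_bounds_Suc_ivl[of "\<lambda>i. F (f i)" k p]
    by (simp only: atLeastLessThanSuc_atLeastAtMost atLeastSucAtMost_greaterThanAtMost)
  finally show ?thesis .
qed

lemma low_sum:
  fixes F :: "nat \<Rightarrow> int"
  shows "(\<Sum>i\<in>{p<..n}. F (h i)) = (\<Sum>i\<in>{p<..n}. F (f i)) - F b + F q"
proof -
  let ?I = "{i \<in> {p<..n}. q < f i \<and> f i \<le> b}" and ?O = "{i \<in> {p<..n}. \<not> (q < f i \<and> f i \<le> b)}"
  have split: "(\<Sum>i\<in>{p<..n}. G i) = (\<Sum>i\<in>?I. G i) + (\<Sum>i\<in>?O. G i)" for G :: "nat \<Rightarrow> int"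
    by (subst sum.union_disjoint[symmetric]) (auto intro: sum.cong)
  have inj: "inj_on f ?I" using bij_betw_imp_inj_on[OF bij] by (rule inj_on_subset) auto
  have "insert b Y = f ` ?I" using b_Y bZ fb by (auto simp: image_iff)
  then have bijI: "bij_betw f ?I (insert b Y)" using inj by (simp add: bij_betw_def)
  have "(\<Sum>i\<in>?I. F (h i)) = (\<Sum>i\<in>?I. F (prv (insert q Y) (f i)))"
    by (intro sum.cong refl) (simp add: h_low_in)
  also have "\<dots> = (\<Sum>j\<in>insert b Y. F (prv (insert q Y) j))"
    using sum.reindex_bij_betw[OF bijI, of "\<lambda>j. F (prv (insert q Y) j)"] .
  also have "\<dots> = (\<Sum>j\<in>insert q Y. F j)"
    using sum.reindex_bij_betw[OF Cols.bij_betw_prv, of F] .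
  also have "\<dots> = F q + sum F Y" by simp
  finally have 1: "(\<Sum>i\<in>?I. F (h i)) = F q + sum F Y" .
  have "(\<Sum>i\<in>?I. F (f i)) = (\<Sum>j\<in>insert b Y. F j)"
    using sum.reindex_bij_betw[OF bijI, of F] .
  then have 2: "(\<Sum>i\<in>?I. F (f i)) = F b + sum F Y" by simp
  have 3: "(\<Sum>i\<in>?O. F (h i)) = (\<Sum>i\<in>?O. F (f i))"
    by (intro sum.cong refl arg_cong[where f = F] h_low_out) auto
  show ?thesis unfolding split[of "\<lambda>i. F (f i)"] split[of "\<lambda>i. F (h i)"] 1 2 3 by simp
qed

lemma h_eq_q: "\<exists>m\<in>{p<..n}. h m = q"
proof -
  have "0 \<le> (\<Sum>i\<in>{p<..n}. of_bool (f i = q) :: int)" by (intro sum_nonneg) simp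
  then have "(\<Sum>i\<in>{p<..n}. of_bool (h i = q)) \<noteq> (0::int)"
    using low_sum[of "\<lambda>x. of_bool (x = q)"] fb by simp
  then show ?thesis using sum_of_bool_neq_0_iff[of "{p<..n}" "\<lambda>i. h i = q"] by simp
qed

text \<open>The row \<open>m\<close> is not part of the data: it is where moving the columns back
  recreates \<open>q\<close> below row \<open>p\<close>.\<close>

lemma ex_one_minus: "\<exists>m. one_minus n h k p m b"
proof -
  obtain m where m: "m \<in> {p<..n}" "h m = q" using h_eq_q by blast
  have mn: "m \<in> {1..n}" using m by auto
  have "bij_betw (h(m := b)) {1..n} {1..n}"
  proof (rule bij_betw_if_sums_eq[OF _ bij])
    fix F :: "nat \<Rightarrow> int"
    note blocks = sum_blocks(1)[OF less_imp_le[OF kp] pn]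
    have "(\<Sum>i\<in>{1..k}. F (h i)) = (\<Sum>i\<in>{1..k}. F (f i))"
      by (intro sum.cong refl) (simp add: h_upper)
    then have "(\<Sum>i\<in>{1..n}. F (h i)) = (\<Sum>i\<in>{1..n}. F (f i)) - F b + F q"
      unfolding blocks mid_sum low_sum by simp
    moreover have "(\<Sum>i\<in>{1..n}. F (h i)) = F q + (\<Sum>i\<in>{1..n} - {m}. F (h i))"
      using sum.remove[OF _ mn, of "\<lambda>i. F (h i)"] m(2) by simp
    moreover have "(\<Sum>i\<in>{1..n} - {m}. F ((h(m := b)) i)) = (\<Sum>i\<in>{1..n} - {m}. F (h i))"
      by (intro sum.cong) auto
    moreover have "(\<Sum>i\<in>{1..n}. F ((h(m := b)) i)) = F b + (\<Sum>i\<in>{1..n} - {m}. F ((h(m := b)) i))"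
      using sum.remove[OF _ mn, of "\<lambda>i. F ((h(m := b)) i)"] by simp
    ultimately show "(\<Sum>i\<in>{1..n}. F ((h(m := b)) i)) = (\<Sum>i\<in>{1..n}. F (f i))" by linarith
  qed simp
  moreover have "h p < h k"
    using h_mid[of p] prv_X[of p] kp by (simp add: h_upper)
  ultimately have "one_minus n h k p m b"
    using m k1 kp fb by unfold_locales (auto simp: h_upper)
  then show ?thesis ..
qed

lemma X_h: "{i \<in> {k<..<p}. h i < h k} = X"
proof -
  have "h i < q \<longleftrightarrow> f (Suc i) < q" if i: "i \<in> {k<..<p}" for i
  proof (cases "i \<in> insert p X")
    case True
    then have "h i < q" using h_mid[of i] prv_X[OF True] i by auto
    then show ?thesis using True i by auto
  next
    case False
    then have "h i = f (Suc i)" using h_mid[of i] i by auto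
    then show ?thesis by simp
  qed
  then show ?thesis unfolding h_upper[OF order_refl] by blast
qed

lemma Y_h: "{j \<in> {h k<..<b}. \<exists>i\<in>{p<..n}. h i = j} = Y"
proof -
  have "(\<exists>i\<in>{p<..n}. h i = j) \<longleftrightarrow> (\<exists>i\<in>{p<..n}. f i = j)" if "j \<in> {q<..<b}" for j
    using low_sum[of "\<lambda>x. of_bool (x = j)"] that
    by (simp add: sum_of_bool_neq_0_iff[symmetric])
  then show ?thesis unfolding h_upper[OF order_refl] by blast
qed

text \<open>Together with \<open>recharge_f\<close>, this makes the two maps mutually inverse on
  rows 1 to \<open>n\<close> for fixed \<open>k\<close>, \<open>p\<close>, \<open>b\<close>.\<close>

lemma discharge_h:
  assumes "i \<in> {1..n}" shows "discharge n h k p b i = f i"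
proof -
  have hk: "h k = q" by (simp add: h_upper)
  have discharge: "discharge n h k p b i =
    (if i \<le> k then h i
     else if i \<le> p then (if i - 1 \<in> insert k X then h (nxt (insert p X) (i - 1)) else h (i - 1))
     else if q \<le> h i \<and> h i < b then nxt (insert b Y) (h i) else h i)"
    unfolding discharge_def Let_def hk X_h[unfolded hk] Y_h[unfolded hk] ..
  consider "i \<le> k" | "k < i" "i \<le> p" | "p < i" by linarith
  then show ?thesis
  proof cases
    case 1 then show ?thesis unfolding discharge by (simp add: h_upper)
  next
    case 2
    define t where "t = i - 1"
    have t: "i = Suc t" "t \<in> {k..<p}" using 2 by (auto simp: t_def)
    have "(if t \<in> insert k X then h (nxt (insert p X) t) else h t) = f i"
    proof (cases "t \<in> insert k X")
      case True
      have u: "nxt (insert p X) t \<in> insert p X" "nxt (insert p X) t \<in> {k<..p}"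
        using Rows.nxt_props(1,2)[OF True] kp by auto
      have "h (nxt (insert p X) t) = f (Suc t)"
        using h_mid[OF u(2)] u(1) Rows.prv_nxt[OF True] by presburger
      then show ?thesis using True t by presburger
    next
      case False
      then have "h t = f (Suc t)" using h_mid[of t] t by auto
      then show ?thesis using False t by presburger
    qed
    then show ?thesis unfolding discharge using 2 by (simp only: t_def not_le[symmetric] if_True if_False simp_thms)
  next
    case 3
    then have i: "i \<in> {p<..n}" using assms by simp
    have np: "\<not> i \<le> k" "\<not> i \<le> p" using 3 kp by auto
    show ?thesis
    proof (cases "q < f i \<and> f i \<le> b")
      case True
      then have y: "f i \<in> insert b Y" using b_Y i by blast
      have hi: "h i = prv (insert q Y) (f i)" by (rule h_low_in[OF i True])
      have r: "q \<le> h i \<and> h i < b"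
        unfolding hi using Cols.prv_props(1,2)[OF y] True by auto
      have "nxt (insert b Y) (h i) = f i" unfolding hi by (rule Cols.nxt_prv[OF y])
      then show ?thesis unfolding discharge using np r by (simp only: if_True if_False simp_thms)
    next
      case False
      then have hi: "h i = f i" by (rule h_low_out[OF i])
      \<comment> \<open>\<open>f\<close> takes the value \<open>q\<close> only in row
        \<open>k\<close>, which settles the end of the interval where the two case conditions
        differ.\<close>
      have "f i \<noteq> q" using inj_f[of i k] i k1 kp pn by auto
      then have "\<not> (q \<le> h i \<and> h i < b)" using False hi by auto
      then show ?thesis unfolding discharge using np hi by (simp only: if_True if_False simp_thms)
    qed
  qed
qed

end

section \<open>The range of the complete discharging procedure\<close>

lemma permmat_cong: "(\<And>i. i \<in> {1..n} \<Longrightarrow> f i = g i) \<Longrightarrow> permmat n f = permmat n g"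
  by (intro ext) (auto simp: permmat_def)

lemma asmat_cong:
  assumes "\<And>i. i \<in> {1..n} \<Longrightarrow> f i = g i" shows "asmat n f = asmat n g"
  using permmat_cong[OF assms] by (intro ext) (simp add: asmat_def)

lemma permmat_eqD: "permmat n f = permmat n g \<Longrightarrow> i \<in> {1..n} \<Longrightarrow> f i = g i"
  by (drule fun_cong[of _ _ i], drule fun_cong[of _ _ "f i"]) (auto simp: permmat_def split: if_splits)

lemma inv_on_cong: "(\<And>i. i \<in> S \<Longrightarrow> f i = g i) \<Longrightarrow> inv_on S f = inv_on S g"
  unfolding inv_on_def by (intro sum.cong refl) simp

context one_minus
begin

lemma Echarge_A: "is_positive A \<or> is_neutral A \<Longrightarrow> Echarge n A = charge_cell n A"
  by (auto simp: Echarge_def is_neutral_A charge_cell_A)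

text \<open>In a positive matrix the lowest enclosed row itself contributes to the charge.\<close>

lemma Echarge_A_eq_0_iff:
  assumes "is_positive A \<or> is_neutral A" shows "Echarge n A = 0 \<longleftrightarrow> is_neutral A"
proof (cases "is_neutral A")
  case False
  then have "p - 1 \<in> {k<..<p}" "q < h (p - 1)" using assms kp by (auto simp: is_neutral_A is_positive_A)
  then have "(\<Sum>i\<in>{k<..<p}. of_bool (q < h i)) \<noteq> (0::int)"
    by (subst sum_of_bool_neq_0_iff) auto
  then show ?thesis using False Echarge_A[OF assms] by (simp add: charge_cell_A)
qed (simp add: Echarge_def is_positive_def)

lemma ell_nonneg: "0 \<le> ell n A" and cpar_nonneg: "0 \<le> cpar n A"
  unfolding ell_A cpar_A by (intro sum_nonneg; simp)+

lemma discharged_f: "discharged n f k p b"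
proof
  show "b \<in> f ` {p<..n}" using f_eq_b by (metis imageI)
qed (use bij_f k1 kp pn f_Suc_k_less hb f_k in auto)

end

section \<open>Statistics of a recharged matrix\<close>

context discharged
begin

abbreviation "D \<equiv> asmat n h p q b"

text \<open>\<open>ell\<close>, the first \<open>k\<close> rows, and the inversions minus charge and
  \<open>cpar\<close> involve only \<open>f\<close> and \<open>k\<close>. The choices of
  \<open>p\<close> and \<open>b\<close> enter through the charge, \<open>cpar\<close> and the sign
  condition.\<close>

lemma D_props:
  shows D_asm: "D \<in> asm_set n 1"
    and opening_row_D: "opening_row D = k"
    and nonneg_D: "is_positive D \<or> is_neutral D \<longleftrightarrow> p = Suc k \<or> q < f p"
    and delta_D: "delta n D = permmat n f"
    and cpar_D: "cpar n D + 1 = (\<Sum>i\<in>{p<..n}. of_bool (q < f i \<and> f i \<le> b))"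
    and charge_cell_D: "charge_cell n D = (\<Sum>i\<in>{k<..p}. of_bool (q < f i))"
    and Echarge_D: "is_positive D \<or> is_neutral D \<Longrightarrow> Echarge n D = charge_cell n D"
    and ell_D: "ell n D = (\<Sum>i\<in>{k<..n}. of_bool (f (Suc k) < f i \<and> f i < q))"
    and inversions_D: "inversions n D = inv_on {1..n} f + charge_cell n D + cpar n D + 1"
    and upper_D: "i \<le> k \<Longrightarrow> D i j = permmat n f i j"
proof -
  obtain m where "one_minus n h k p m b" using ex_one_minus ..
  then interpret O: one_minus n h k p m b .
  have hk: "h k = q" by (simp add: h_upper)
  have rng: "{p<..n} \<subseteq> {1..n}" "{k<..n} \<subseteq> {1..n}" "{k<..p} \<subseteq> {1..n}" "Suc k \<in> {1..n}" "p \<in> {1..n}"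
    using kp pn by auto
  have eq: "discharge n h k p b i = f i" if "i \<in> {1..n}" for i by (rule discharge_h[OF that])
  have sums: "(\<Sum>i\<in>S. F (discharge n h k p b i)) = (\<Sum>i\<in>S. F (f i))" if "S \<subseteq> {1..n}" for S and F :: "nat \<Rightarrow> int"
    using eq that by (intro sum.cong refl arg_cong[where f = F]) blast
  show "D \<in> asm_set n 1" using O.A_in_asm_set by (simp only: hk)
  show "opening_row D = k" using O.opening_row_A by (simp only: hk)
  show "is_positive D \<or> is_neutral D \<longleftrightarrow> p = Suc k \<or> q < f p"
    using O.nonneg_A O.f_p eq[OF rng(5)] unfolding hk by auto
  show "delta n D = permmat n f"
    using O.delta_A permmat_cong[of n "discharge n h k p b" f] eq unfolding hk by simp
  show "cpar n D + 1 = (\<Sum>i\<in>{p<..n}. of_bool (q < f i \<and> f i \<le> b))"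
    using O.cpar_f[unfolded hk] sums[OF rng(1), of "\<lambda>x. of_bool (q < x \<and> x \<le> b)"] by (rule trans)
  show "charge_cell n D = (\<Sum>i\<in>{k<..p}. of_bool (q < f i))"
    using O.charge_cell_f[unfolded hk] sums[OF rng(3), of "\<lambda>x. of_bool (q < x)"] by (rule trans)
  show "Echarge n D = charge_cell n D" if "is_positive D \<or> is_neutral D"
    using O.Echarge_A that unfolding hk .
  show "ell n D = (\<Sum>i\<in>{k<..n}. of_bool (f (Suc k) < f i \<and> f i < q))"
    using O.ell_f[unfolded hk eq[OF rng(4)]]
      sums[OF rng(2), of "\<lambda>x. of_bool (f (Suc k) < x \<and> x < q)"] by (rule trans)
  show "inversions n D = inv_on {1..n} f + charge_cell n D + cpar n D + 1"
    using O.inversions_f inv_on_cong[of "{1..n}" "discharge n h k p b" f] eq unfolding hk by simp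
  show "D i j = permmat n f i j" if "i \<le> k"
    using that kp by (simp add: asmat_def permmat_def h_upper)
qed

end

text \<open>A permutation matrix determines \<open>f\<close> only on rows 1 to \<open>n\<close>;
  making \<open>f\<close> zero elsewhere lets equal matrices yield equal functions.\<close>

lemma asm_set_1_nonneg_obtain:
  assumes "A \<in> asm_set n 1" "is_positive A \<or> is_neutral A"
  obtains f p b where "discharged n f (opening_row A) p b"
    "A = asmat n (recharge n f (opening_row A) p b) p (f (opening_row A)) b"
    "p = Suc (opening_row A) \<or> f (opening_row A) < f p" "\<And>i. i \<notin> {1..n} \<Longrightarrow> f i = 0"
proof -
  obtain h' k p m b where om: "one_minus n h' k p m b" and A': "A = asmat n h' p (h' k) b"
    using asm_set_1_obtain[OF assms(1)] .
  define h where "h = (\<lambda>i. if i \<in> {1..n} then h' i else 0)"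
  have k: "k \<in> {1..n}" "p \<in> {1..n}" "m \<in> {1..n}" using om by (auto simp: one_minus_def)
  have "bij_betw (h(m := b)) {1..n} {1..n} \<longleftrightarrow> bij_betw (h'(m := b)) {1..n} {1..n}"
    by (rule bij_betw_cong) (simp add: h_def)
  then have "one_minus n h k p m b" using om k unfolding one_minus_def by (simp add: h_def)
  then interpret one_minus n h k p m b .
  have A: "A = asmat n h p (h k) b"
    using A' asmat_cong[of n h h'] k by (simp add: h_def)
  have kA: "opening_row A = k" unfolding A by (rule opening_row_A)
  show thesis
  proof (rule that, unfold kA)
    show "discharged n f k p b" by (rule discharged_f)
    show "A = asmat n (recharge n f k p b) p (f k) b"
      unfolding A f_k using asmat_cong[of n "recharge n f k p b" h] recharge_f by simp
    show "p = Suc k \<or> f k < f p" using assms(2) nonneg_A f_p f_k unfolding A by auto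
    \<comment> \<open>Row 0 lies above \<open>k\<close>, and a row past \<open>n\<close> has the
      value 0, which is left of \<open>q\<close>; neither is moved.\<close>
    show "f i = 0" if "i \<notin> {1..n}" for i
    proof -
      have "h i = 0" using that by (simp only: h_def if_False)
      moreover have "1 \<le> q" using h_range[OF k(1)] by simp
      ultimately show ?thesis using that k1 pn by (auto simp: discharge_def Let_def not_le)
    qed
  qed
qed

text \<open>\<open>E > 0\<close> selects \<open>p\<close> as the row of the \<open>E\<close>-th
  right entry below row \<open>k\<close>; then \<open>c\<close> selects \<open>b\<close> as the
  \<open>(c + 1)\<close>-st column right of \<open>f k\<close> among the entries below
  \<open>p\<close>. The bound leaves enough entries for both.\<close>

lemma Delta_attained:
  assumes f: "bij_betw f {1..n} {1..n}" and k: "1 \<le> k" "k < n" "f (Suc k) < f k"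
    and cE: "0 \<le> c" "0 \<le> E" "c + E + 1 \<le> (\<Sum>i\<in>{k<..n}. of_bool (f k < f i))"
  obtains A where "A \<in> asm_set n 1" "is_positive A \<or> is_neutral A"
    "Delta n A = (k, permmat n f, c, E)"
proof -
  obtain p where p: "p \<in> {k<..n}" "p = Suc k \<or> f k < f p" "(\<Sum>i\<in>{k<..p}. of_bool (f k < f i)) = E"
  proof (cases "E = 0")
    case True
    \<comment> \<open>For \<open>E = 0\<close> the row \<open>p\<close> is \<open>k + 1\<close>,
      where the descent makes the count 0.\<close>
    have "{k<..Suc k} = {Suc k}" by auto
    then have "(\<Sum>i\<in>{k<..Suc k}. of_bool (f k < f i)) = (0::int)" using k by simp
    then show ?thesis using that[of "Suc k"] k True by auto
  next
    case False
    then show ?thesis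
      using count_attained[of E "\<lambda>i. f k < f i" k n] cE that by fastforce
  qed
  have "(\<Sum>i\<in>{k<..n}. of_bool (f k < f i)) = E + (\<Sum>i\<in>{p<..n}. of_bool (f k < f i))"
    using sum_blocks(2)[of k p n "\<lambda>i. of_bool (f k < f i)"] p by simp
  moreover have inj: "inj_on f {p<..n}" using bij_betw_imp_inj_on[OF f] by (rule inj_on_subset) auto
  moreover have "(\<Sum>i\<in>{p<..n}. of_bool (f k < f i)) = (\<Sum>i\<in>{p<..n}. of_bool (f k < f i \<and> f i \<le> n) :: int)"
    using bij_betwE[OF f] by (intro sum.cong) auto
  ultimately have "c + 1 \<le> (\<Sum>j\<in>{f k<..n}. of_bool (j \<in> f ` {p<..n}))"
    using cE count_image[OF inj, of "f k" n] by simp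
  then obtain b where b: "b \<in> {f k<..n}" "b \<in> f ` {p<..n}"
    "(\<Sum>j\<in>{f k<..b}. of_bool (j \<in> f ` {p<..n})) = c + 1"
    using count_attained[of "c + 1" "\<lambda>j. j \<in> f ` {p<..n}" "f k" n] cE by auto
  interpret discharged n f k p b by unfold_locales (use f k p b in auto)
  have nn: "is_positive D \<or> is_neutral D" using nonneg_D p by blast
  have "cpar n D + 1 = c + 1" unfolding cpar_D using count_image[OF inj, of q b] b(3) by simp
  then have "Delta n D = (k, permmat n f, c, E)"
    unfolding Delta_def opening_row_D delta_D Echarge_D[OF nn] charge_cell_D p(3) by simp
  then show thesis using that D_asm nn by blast
qed

text \<open>Converse of \<open>Delta_attained\<close>. The upper bound involves only the sum of
  \<open>c\<close> and \<open>E\<close>, which is why charge can be traded for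
  \<open>c\<close>.\<close>

lemma Delta_range:
  assumes "A \<in> asm_set n 1" "is_positive A \<or> is_neutral A"
  obtains f where "bij_betw f {1..n} {1..n}" "1 \<le> opening_row A" "opening_row A < n"
    "f (Suc (opening_row A)) < f (opening_row A)" "delta n A = permmat n f"
    "0 \<le> cpar n A" "0 \<le> Echarge n A"
    "cpar n A + Echarge n A + 1 \<le> (\<Sum>i\<in>{opening_row A<..n}. of_bool (f (opening_row A) < f i))"
proof -
  let ?k = "opening_row A"
  obtain f p b where c: "discharged n f ?k p b" and A: "A = asmat n (recharge n f ?k p b) p (f ?k) b"
    and "p = Suc ?k \<or> f ?k < f p"
    using asm_set_1_nonneg_obtain[OF assms] by metis
  interpret discharged n f ?k p b by (rule c)
  have E: "Echarge n A = (\<Sum>i\<in>{?k<..p}. of_bool (q < f i))"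
    using Echarge_D charge_cell_D assms(2) A by simp
  have C: "cpar n A + 1 = (\<Sum>i\<in>{p<..n}. of_bool (q < f i \<and> f i \<le> b))" using cpar_D A by simp
  show thesis
  proof (rule that)
    show "bij_betw f {1..n} {1..n}" "1 \<le> ?k" "?k < n" "f (Suc ?k) < f ?k" using bij k1 kp pn fk by auto
    show "delta n A = permmat n f" using delta_D A by simp
    show "0 \<le> Echarge n A" unfolding E by (intro sum_nonneg) simp
    obtain i where i: "i \<in> {p<..n}" "f i = b" using bZ by auto
    then have "1 \<le> (\<Sum>i\<in>{p<..n}. of_bool (q < f i \<and> f i \<le> b) :: int)"
      using member_le_sum[of i "{p<..n}" "\<lambda>i. of_bool (q < f i \<and> f i \<le> b) :: int"] fb by simp
    then show "0 \<le> cpar n A" using C by linarith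
    have "(\<Sum>i\<in>{p<..n}. of_bool (q < f i \<and> f i \<le> b)) \<le> (\<Sum>i\<in>{p<..n}. of_bool (q < f i) :: int)"
      by (intro sum_mono) simp
    then show "cpar n A + Echarge n A + 1 \<le> (\<Sum>i\<in>{?k<..n}. of_bool (q < f i))"
      using C E sum_blocks(2)[of ?k p n "\<lambda>i. of_bool (q < f i)"] kp pn by simp
  qed
qed

text \<open>Both matrices recharge the same \<open>f\<close>, so what depends on \<open>f\<close>
  and \<open>k\<close> alone agrees. The last claim is the injectivity of \<open>Delta\<close>:
  counting returns \<open>p\<close> from \<open>E\<close> and then \<open>b\<close> from
  \<open>c\<close>.\<close>

lemma same_delta:
  assumes A: "A \<in> asm_set n 1" "is_positive A \<or> is_neutral A"
    and N: "N \<in> asm_set n 1" "is_positive N \<or> is_neutral N"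
    and row: "opening_row N = opening_row A" and d: "delta n N = delta n A"
  shows "ell n N = ell n A"
    and "inversions n N - Echarge n N - cpar n N = inversions n A - Echarge n A - cpar n A"
    and "i \<le> opening_row A \<Longrightarrow> N i j = A i j"
    and "cpar n N = cpar n A \<Longrightarrow> Echarge n N = Echarge n A \<Longrightarrow> N = A"
proof -
  let ?k = "opening_row A"
  obtain f p b where fc: "discharged n f ?k p b" and fA: "A = asmat n (recharge n f ?k p b) p (f ?k) b"
    and fp: "p = Suc ?k \<or> f ?k < f p" and f0: "\<And>i. i \<notin> {1..n} \<Longrightarrow> f i = 0"
    using asm_set_1_nonneg_obtain[OF A] by metis
  obtain g p' b' where gc: "discharged n g ?k p' b'" and gN: "N = asmat n (recharge n g ?k p' b') p' (g ?k) b'"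
    and gp: "p' = Suc ?k \<or> g ?k < g p'" and g0: "\<And>i. i \<notin> {1..n} \<Longrightarrow> g i = 0"
    using asm_set_1_nonneg_obtain[OF N] unfolding row by metis
  interpret F: discharged n f ?k p b by (rule fc)
  interpret G: discharged n g ?k p' b' by (rule gc)
  have "permmat n g = permmat n f" using d F.delta_D G.delta_D fA gN by metis
  then have gf: "g = f" using permmat_eqD f0 g0 by (metis ext)
  show "ell n N = ell n A" using F.ell_D G.ell_D fA gN unfolding gf by metis
  have iA: "inversions n A = inv_on {1..n} f + charge_cell n A + cpar n A + 1"
    "Echarge n A = charge_cell n A" using F.inversions_D F.Echarge_D A(2) unfolding fA[symmetric] by auto
  have iN: "inversions n N = inv_on {1..n} f + charge_cell n N + cpar n N + 1"
    "Echarge n N = charge_cell n N" using G.inversions_D G.Echarge_D N(2) unfolding gN[symmetric] unfolding gf by auto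
  show "inversions n N - Echarge n N - cpar n N = inversions n A - Echarge n A - cpar n A"
    using iA iN by simp
  show "N i j = A i j" if "i \<le> ?k"
    using F.upper_D[OF that] G.upper_D[OF that] unfolding fA[symmetric] gN[symmetric] unfolding gf by simp
  assume c: "cpar n N = cpar n A" and E: "Echarge n N = Echarge n A"
  have "(\<Sum>i\<in>{?k<..p}. of_bool (f ?k < f i)) = (\<Sum>i\<in>{?k<..p'}. of_bool (f ?k < f i) :: int)"
    using F.charge_cell_D G.charge_cell_D iA(2) iN(2) E unfolding fA[symmetric] gN[symmetric] unfolding gf by simp
  then have p: "p' = p" using count_inj[of ?k p p' "\<lambda>i. f ?k < f i"] F.kp G.kp fp gp unfolding gf by simp
  have inj: "inj_on f {p<..n}" using bij_betw_imp_inj_on[OF F.bij] by (rule inj_on_subset) auto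
  have "(\<Sum>j\<in>{f ?k<..b}. of_bool (j \<in> f ` {p<..n})) = (\<Sum>j\<in>{f ?k<..b'}. of_bool (j \<in> f ` {p<..n}) :: int)"
    using F.cpar_D G.cpar_D c count_image[OF inj, of "f ?k"]
    unfolding fA[symmetric] gN[symmetric] unfolding gf p by simp
  then have "b' = b"
    using count_inj[of "f ?k" b b' "\<lambda>j. j \<in> f ` {p<..n}"] F.fb F.bZ G.fb G.bZ unfolding gf p by simp
  with gN have "N = asmat n (recharge n f ?k p b) p (f ?k) b" unfolding gf p by (simp only:)
  from this fA[symmetric] show "N = A" by (rule trans)
qed

section \<open>Reflection\<close>

context one_minus
begin

text \<open>Row \<open>p\<close> uses \<open>b\<close> because reflection turns the closing 1 into
  the left 1.\<close>

definition "h' i = Suc n - (if i = p then b else h i)"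

lemma h'_k: "h' k = Suc n - q"
  using kp by (simp add: h'_def)

text \<open>The new permutation is the mirrored \<open>h(m := b)\<close> with the values in rows
  \<open>p\<close> and \<open>m\<close> exchanged, so all sums agree.\<close>

lemma one_minus_reflect: "one_minus n h' k p m (Suc n - h p)"
proof
  have r: "h p \<in> {1..n}" "q \<in> {1..n}" using h_range[of p] h_range[of k] k1 kp pn by auto
  show "1 \<le> k" "k < p" "p < m" "m \<le> n" by (rule k1 kp pm mn)+
  show "h' m = h' k" using hm kp pm by (simp add: h'_def)
  show "h' p < h' k" "h' k < Suc n - h p" using kp hb hp r b_range by (auto simp: h'_def)
  let ?r = "\<lambda>j. Suc n - j" and ?s = "h(m := b)"
  have "bij_betw ?r {1..n} {1..n}"
    by (rule bij_betw_byWitness[where f' = ?r]) auto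
  then have "bij_betw (?r \<circ> ?s) {1..n} {1..n}" using bij by (rule bij_betw_trans[rotated])
  then show "bij_betw (h'(m := Suc n - h p)) {1..n} {1..n}"
  proof (rule bij_betw_if_sums_eq[rotated])
    fix F :: "nat \<Rightarrow> int"
    let ?S = "{1..n} - {p} - {m}"
    have split: "(\<Sum>i\<in>{1..n}. G i) = G p + G m + (\<Sum>i\<in>?S. G i)" for G :: "nat \<Rightarrow> int"
      using sum.remove[of "{1..n}" p G] sum.remove[of "{1..n} - {p}" m G] k1 kp pm mn by simp
    have "(\<Sum>i\<in>?S. F ((h'(m := Suc n - h p)) i)) = (\<Sum>i\<in>?S. F ((?r \<circ> ?s) i))"
      by (intro sum.cong refl) (simp add: h'_def)
    then show "(\<Sum>i\<in>{1..n}. F ((h'(m := Suc n - h p)) i)) = (\<Sum>i\<in>{1..n}. F ((?r \<circ> ?s) i))"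
      unfolding split using pm by (simp add: h'_def)
  qed simp
qed

lemma reflect_A: "reflect n A = asmat n h' p (h' k) (Suc n - h p)"
proof (intro ext)
  fix i j
  show "reflect n A i j = asmat n h' p (h' k) (Suc n - h p) i j"
  proof (cases "i \<in> {1..n} \<and> j \<in> {1..n}")
    case True
    have r: "h i \<in> {1..n}" "h p \<in> {1..n}" "q \<in> {1..n}" using h_range[of p] h_range[of k] h_range True k1 kp pn by auto
    have e: "Suc n - j = t \<longleftrightarrow> j = Suc n - t" if "t \<in> {1..n}" for t using that True by auto
    have "reflect n A i j = A i (Suc n - j)" using True by (simp add: reflect_def)
    also have "\<dots> = asmat n h' p (h' k) (Suc n - h p) i j"
      using True h_neq_b[of p] hp hb
      unfolding asmat_def permmat_def h'_k e[OF r(1)] e[OF r(3)] e[OF b_range]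
      by (auto simp: h'_def)
    finally show ?thesis .
  next
    case False
    then have "asmat n h' p (h' k) (Suc n - h p) i j = 0"
      using one_minus.A_outside[OF one_minus_reflect, of i j] by blast
    moreover have "reflect n A i j = 0" using False A_outside[of i "Suc n - j"] by (auto simp: reflect_def)
    ultimately show ?thesis by simp
  qed
qed

lemma reflect_A_props:
  shows "reflect n A \<in> asm_set n 1"
    and "opening_row (reflect n A) = opening_row A"
    and "is_neutral (reflect n A) = is_neutral A"
    and "is_positive (reflect n A) = is_negative A"
    and "is_negative (reflect n A) = is_positive A"
    and "is_neutral A \<Longrightarrow> ell n A = cpar n (reflect n A)"
proof -
  interpret R: one_minus n h' k p m "Suc n - h p" by (rule one_minus_reflect)
  show "reflect n A \<in> asm_set n 1" unfolding reflect_A by (rule R.A_in_asm_set)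
  show "opening_row (reflect n A) = opening_row A" unfolding reflect_A R.opening_row_A opening_row_A ..
  show n: "is_neutral (reflect n A) = is_neutral A" unfolding reflect_A R.is_neutral_A is_neutral_A ..
  have q: "q \<in> {1..n}" using h_range[of k] k1 kp pn by auto
  have "p - 1 \<in> {1..n}" if "p \<noteq> Suc k" using that k1 kp pn by auto
  then have "p - 1 \<noteq> p" "h (p - 1) \<in> {1..n}" if "p \<noteq> Suc k" using that h_range[of "p - 1"] k1 kp by auto
  then show "is_positive (reflect n A) = is_negative A" "is_negative (reflect n A) = is_positive A"
    unfolding reflect_A R.is_positive_A R.is_negative_A is_negative_A is_positive_A unfolding h'_k
    using q by (auto simp: h'_def)
  show "ell n A = cpar n (reflect n A)" if "is_neutral A"
  proof -
    have pk: "p = Suc k" using that by (simp add: is_neutral_A)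
    then have X: "{i \<in> {k<..<p}. h i < q} = {}" by auto
    have "{y \<in> {p}. k < y} = {p}" using kp by auto
    \<comment> \<open>Without enclosed rows the leading 1 is the left 1 of row \<open>p\<close>,
      which reflection turns into the closing 1.\<close>
    then have lc: "leading_col A = h p" unfolding leading_col_A X nxt_def by simp
    have e: "{k<..n} = insert p {p<..n}" using pk pn by auto
    have "ell n A = (\<Sum>i\<in>{p<..n}. of_bool (h p < h i \<and> h i < q))"
      unfolding ell_A lc e by simp
    also have "\<dots> = (\<Sum>i\<in>{p<..n}. of_bool (h' k < h' i \<and> h' i < Suc n - h p))"
    proof (intro sum.cong refl arg_cong[where f = of_bool])
      fix i assume i: "i \<in> {p<..n}"
      then have "h i \<in> {1..n}" "i \<noteq> p" using h_range[of i] by auto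
      then show "(h p < h i \<and> h i < q) = (h' k < h' i \<and> h' i < Suc n - h p)"
        unfolding h'_k using q by (auto simp: h'_def)
    qed
    also have "\<dots> = cpar n (reflect n A)" unfolding reflect_A R.cpar_A ..
    finally show ?thesis .
  qed
qed

text \<open>The square of a column sum is 1; it equals the sum of the squares plus twice the
  products over pairs of rows. Since \<open>A\<close> has \<open>n + 2\<close> nonzero entries,
  adding over columns gives \<open>n = 2 T + n + 2\<close> for the total \<open>T\<close>.\<close>

lemma column_products: "(\<Sum>i\<in>{1..n}. \<Sum>i'\<in>{1..n}. of_bool (i < i') * (\<Sum>j\<in>{1..n}. A i j * A i' j)) = -1"
proof -
  have tri: "(\<Sum>i\<in>{1..N}. x i)^2 = 2 * (\<Sum>i\<in>{1..N}. \<Sum>i'\<in>{1..N}. of_bool (i < i') * (x i * x i')) + (\<Sum>i\<in>{1..N}. x i * x i)"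
    for N :: nat and x :: "nat \<Rightarrow> int"
  proof -
    have "(\<Sum>i\<in>{1..N}. x i)^2 = (\<Sum>i\<in>{1..N}. \<Sum>i'\<in>{1..N}. x i * x i')"
      by (simp add: power2_eq_square sum_product)
    also have "\<dots> = (\<Sum>i\<in>{1..N}. \<Sum>i'\<in>{1..N}. of_bool (i < i') * (x i * x i')
        + of_bool (i' < i) * (x i' * x i) + (if i' = i then x i * x i else 0))"
      by (intro sum.cong refl) auto
    also have "\<dots> = (\<Sum>i\<in>{1..N}. \<Sum>i'\<in>{1..N}. of_bool (i < i') * (x i * x i'))
        + (\<Sum>i\<in>{1..N}. \<Sum>i'\<in>{1..N}. of_bool (i' < i) * (x i' * x i)) + (\<Sum>i\<in>{1..N}. x i * x i)"
      by (simp add: sum.distrib)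
    also have "(\<Sum>i\<in>{1..N}. \<Sum>i'\<in>{1..N}. of_bool (i' < i) * (x i' * x i))
        = (\<Sum>i\<in>{1..N}. \<Sum>i'\<in>{1..N}. of_bool (i < i') * (x i * x i'))" by (rule sum.swap)
    finally show ?thesis by simp
  qed
  let ?T = "\<lambda>j. \<Sum>i\<in>{1..n}. \<Sum>i'\<in>{1..n}. of_bool (i < i') * (A i j * A i' j)"
  have "(\<Sum>i\<in>{1..n}. \<Sum>i'\<in>{1..n}. of_bool (i < i') * (\<Sum>j\<in>{1..n}. A i j * A i' j)) = (\<Sum>j\<in>{1..n}. ?T j)"
  proof -
    have "(\<Sum>i\<in>{1..n}. \<Sum>i'\<in>{1..n}. of_bool (i < i') * (\<Sum>j\<in>{1..n}. A i j * A i' j))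
      = (\<Sum>i\<in>{1..n}. \<Sum>j\<in>{1..n}. \<Sum>i'\<in>{1..n}. of_bool (i < i') * (A i j * A i' j))"
      unfolding sum_distrib_left by (intro sum.cong refl sum.swap)
    also have "\<dots> = (\<Sum>j\<in>{1..n}. ?T j)" by (rule sum.swap)
    finally show ?thesis .
  qed
  moreover have "(1::int) = 2 * ?T j + (\<Sum>i\<in>{1..n}. A i j * A i j)" if "j \<in> {1..n}" for j
  proof -
    have "(\<Sum>i\<in>{1..n}. A i j) = 1" using is_asm_A that unfolding is_asm_iff_partial_sums by blast
    then show ?thesis using tri[where x = "\<lambda>i. A i j" and N = n] by simp
  qed
  then have "(\<Sum>j\<in>{1..n}. 1) = (\<Sum>j\<in>{1..n}. 2 * ?T j + (\<Sum>i\<in>{1..n}. A i j * A i j))"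
    by (rule sum.cong[OF refl])
  moreover have "\<dots> = 2 * (\<Sum>j\<in>{1..n}. ?T j) + (\<Sum>i\<in>{1..n}. \<Sum>j\<in>{1..n}. A i j * A i j)"
    unfolding sum.distrib sum_distrib_left[symmetric] by (subst sum.swap) (rule refl)
  moreover have "(\<Sum>i\<in>{1..n}. \<Sum>j\<in>{1..n}. A i j * A i j) = (\<Sum>i\<in>{1..n}. 1 + (if i = p then 2 else 0))"
  proof (intro sum.cong refl)
    fix i assume i: "i \<in> {1..n}"
    have "A i (h i) = 1" "i = p \<Longrightarrow> A i b = 1" "i = p \<Longrightarrow> A i q = -1"
      using i A_eq_1_iff A_eq_minus_iff by auto
    moreover have "h i \<in> {1..n}" "q \<in> {1..n}" using h_range[OF i] h_range[of k] k1 kp pn by auto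
    ultimately show "(\<Sum>j\<in>{1..n}. A i j * A i j) = 1 + (if i = p then 2 else 0)"
      using row_sum[OF i, of "{1..n}" "A i"] b_range by simp
  qed
  moreover have "\<dots> = int n + 2" using k1 kp pn by (simp add: sum.distrib)
  ultimately show ?thesis by simp
qed

text \<open>Each pair of rows contributes the product of its row sums, which is 1. Pairs of entries
  in different columns count for exactly one of \<open>A\<close> and its reflection, pairs in one
  column for neither, and the latter total -1. As the sum is constant, equality of inversions passes
  to reflections.\<close>

lemma inversions_reflect:
  "inversions n A + inversions n (reflect n A) = (\<Sum>i\<in>{1..n}. \<Sum>i'\<in>{1..n}. of_bool (i < i')) + 1"
proof -
  have inv: "inversions n B = (\<Sum>i\<in>{1..n}. \<Sum>i'\<in>{1..n}. of_bool (i < i') *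
      (\<Sum>j\<in>{1..n}. \<Sum>l\<in>{1..n}. of_bool (l < j) * (B i j * B i' l)))" for B
  proof -
    have "inversions n B = (\<Sum>i\<in>{1..n}. \<Sum>i'\<in>{1..n}. \<Sum>j\<in>{1..n}. \<Sum>l\<in>{1..n}.
      if i < i' \<and> l < j then B i j * B i' l else 0)"
      unfolding inversions_def by (intro sum.cong refl sum.swap)
    then show ?thesis unfolding sum_distrib_left by (simp only:) (intro sum.cong refl, auto)
  qed
  have bij: "bij_betw (\<lambda>j. Suc n - j) {1..n} {1..n}"
    by (rule bij_betw_byWitness[where f' = "\<lambda>j. Suc n - j"]) auto
  have rfl: "(\<Sum>j\<in>{1..n}. \<Sum>l\<in>{1..n}. of_bool (l < j) * (reflect n A i j * reflect n A i' l))
     = (\<Sum>j\<in>{1..n}. \<Sum>l\<in>{1..n}. of_bool (j < l) * (A i j * A i' l))" for i i'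
  proof -
    have "(\<Sum>j\<in>{1..n}. \<Sum>l\<in>{1..n}. of_bool (j < l) * (A i j * A i' l)) =
      (\<Sum>j\<in>{1..n}. \<Sum>l\<in>{1..n}. of_bool (Suc n - j < Suc n - l) * (A i (Suc n - j) * A i' (Suc n - l)))"
      unfolding sum.reindex_bij_betw[OF bij, of "\<lambda>l. of_bool (Suc n - j < l) * (A i (Suc n - j) * A i' l)" for j]
      using sum.reindex_bij_betw[OF bij, of "\<lambda>j. \<Sum>l\<in>{1..n}. of_bool (j < l) * (A i j * A i' l)"] by (rule sym)
    also have "\<dots> = (\<Sum>j\<in>{1..n}. \<Sum>l\<in>{1..n}. of_bool (l < j) * (reflect n A i j * reflect n A i' l))"
      by (intro sum.cong refl) (auto simp: reflect_def)
    finally show ?thesis by simp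
  qed
  have pair: "(\<Sum>j\<in>{1..n}. \<Sum>l\<in>{1..n}. of_bool (l < j) * (A i j * A i' l))
     + (\<Sum>j\<in>{1..n}. \<Sum>l\<in>{1..n}. of_bool (j < l) * (A i j * A i' l))
     = 1 - (\<Sum>j\<in>{1..n}. A i j * A i' j)" if "i \<in> {1..n}" "i' \<in> {1..n}" for i i'
  proof -
    have one: "(\<Sum>j\<in>{1..n}. A i j) = 1" if "i \<in> {1..n}" for i
      using is_asm_A that unfolding is_asm_iff_partial_sums by blast
    have "1 = (\<Sum>j\<in>{1..n}. A i j) * (\<Sum>l\<in>{1..n}. A i' l)" using one that by simp
    also have "\<dots> = (\<Sum>j\<in>{1..n}. \<Sum>l\<in>{1..n}. A i j * A i' l)" by (rule sum_product)
    also have "\<dots> = (\<Sum>j\<in>{1..n}. \<Sum>l\<in>{1..n}. of_bool (l < j) * (A i j * A i' l)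
        + of_bool (j < l) * (A i j * A i' l) + (if l = j then A i j * A i' j else 0))"
      by (intro sum.cong refl) auto
    also have "\<dots> = (\<Sum>j\<in>{1..n}. \<Sum>l\<in>{1..n}. of_bool (l < j) * (A i j * A i' l))
     + (\<Sum>j\<in>{1..n}. \<Sum>l\<in>{1..n}. of_bool (j < l) * (A i j * A i' l)) + (\<Sum>j\<in>{1..n}. A i j * A i' j)"
      by (simp add: sum.distrib)
    finally show ?thesis by simp
  qed
  have "inversions n A + inversions n (reflect n A) = (\<Sum>i\<in>{1..n}. \<Sum>i'\<in>{1..n}. of_bool (i < i') *
      (1 - (\<Sum>j\<in>{1..n}. A i j * A i' j)))"
  proof -
    have "(\<Sum>i\<in>{1..n}. \<Sum>i'\<in>{1..n}. of_bool (i < i') * (1 - (\<Sum>j\<in>{1..n}. A i j * A i' j)))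
      = (\<Sum>i\<in>{1..n}. \<Sum>i'\<in>{1..n}. of_bool (i < i') *
         ((\<Sum>j\<in>{1..n}. \<Sum>l\<in>{1..n}. of_bool (l < j) * (A i j * A i' l))
          + (\<Sum>j\<in>{1..n}. \<Sum>l\<in>{1..n}. of_bool (j < l) * (A i j * A i' l))))"
      by (intro sum.cong refl) (simp only: pair)
    then show ?thesis
      unfolding inv[of A] inv[of "reflect n A"] rfl by (simp only: distrib_left sum.distrib)
  qed
  also have "\<dots> = (\<Sum>i\<in>{1..n}. \<Sum>i'\<in>{1..n}. of_bool (i < i'))
      - (\<Sum>i\<in>{1..n}. \<Sum>i'\<in>{1..n}. of_bool (i < i') * (\<Sum>j\<in>{1..n}. A i j * A i' j))"
    unfolding right_diff_distrib sum_subtractf by simp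
  finally show ?thesis unfolding column_products by simp
qed

end

section \<open>The neutralizing procedure\<close>

lemma asm_set_1_props:
  assumes "A \<in> asm_set n 1"
  shows asm_reflect: "reflect n A \<in> asm_set n 1"
    and asm_reflect_reflect: "reflect n (reflect n A) = A"
    and asm_reflect_row: "opening_row (reflect n A) = opening_row A"
    and asm_reflect_neutral: "is_neutral (reflect n A) = is_neutral A"
    and asm_reflect_positive: "is_positive (reflect n A) = is_negative A"
    and asm_reflect_negative: "is_negative (reflect n A) = is_positive A"
    and asm_neutral_ell: "is_neutral A \<Longrightarrow> ell n A = cpar n (reflect n A)"
    and asm_inversions_reflect:
      "inversions n A + inversions n (reflect n A) = (\<Sum>i\<in>{1..n}. \<Sum>i'\<in>{1..n}. of_bool (i < i')) + 1"
    and asm_not_negative: "\<not> is_negative A \<longleftrightarrow> is_positive A \<or> is_neutral A"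
    and asm_ell_nonneg: "0 \<le> ell n A" and asm_cpar_nonneg: "0 \<le> cpar n A"
    and asm_Echarge_eq_0: "is_positive A \<or> is_neutral A \<Longrightarrow> Echarge n A = 0 \<longleftrightarrow> is_neutral A"
    and asm_row_1: "1 \<le> opening_row A"
proof -
  obtain h k p m b where om: "one_minus n h k p m b" and A: "A = asmat n h p (h k) b"
    using asm_set_1_obtain[OF assms] .
  interpret one_minus n h k p m b by (rule om)
  show "reflect n A \<in> asm_set n 1" "opening_row (reflect n A) = opening_row A"
    "is_neutral (reflect n A) = is_neutral A" "is_positive (reflect n A) = is_negative A"
    "is_negative (reflect n A) = is_positive A"
    unfolding A by (rule reflect_A_props)+
  show "ell n A = cpar n (reflect n A)" if "is_neutral A"
    using that unfolding A by (rule reflect_A_props)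
  show "inversions n A + inversions n (reflect n A) = (\<Sum>i\<in>{1..n}. \<Sum>i'\<in>{1..n}. of_bool (i < i')) + 1"
    unfolding A by (rule inversions_reflect)
  show "\<not> is_negative A \<longleftrightarrow> is_positive A \<or> is_neutral A" unfolding A by (rule not_negative_A)
  show "0 \<le> ell n A" "0 \<le> cpar n A" unfolding A by (rule ell_nonneg cpar_nonneg)+
  show "Echarge n A = 0 \<longleftrightarrow> is_neutral A" if "is_positive A \<or> is_neutral A"
    using that unfolding A by (rule Echarge_A_eq_0_iff)
  show "1 \<le> opening_row A" unfolding A opening_row_A by (rule k1)
  show "reflect n (reflect n A) = A"
  proof (intro ext)
    fix i j
    show "reflect n (reflect n A) i j = A i j"
      using A_outside[of i j] unfolding A by (auto simp: reflect_def)
  qed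
qed

text \<open>\<open>Delta_attained\<close> applies to \<open>c + E\<close> and charge 0 since its
  bound sees only the sum. \<open>same_delta\<close> gives uniqueness for the \<open>THE\<close> and
  the invariants; charge 0 gives neutrality.\<close>

lemma Lam0_nonneg:
  assumes A: "A \<in> asm_set n 1" "is_positive A \<or> is_neutral A"
  obtains N where "Lam0 n A = (N, Echarge n A)" "N \<in> asm_set n 1" "is_neutral N"
    "opening_row N = opening_row A" "delta n N = delta n A" "cpar n N = cpar n A + Echarge n A"
    "0 \<le> Echarge n A" "Echarge n A \<le> cpar n N" "ell n N = ell n A"
    "inversions n N = inversions n A" "\<And>i j. i \<le> opening_row A \<Longrightarrow> N i j = A i j"
    "is_neutral A \<Longrightarrow> N = A"
proof -
  obtain f where f: "bij_betw f {1..n} {1..n}" "1 \<le> opening_row A" "opening_row A < n"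
    "f (Suc (opening_row A)) < f (opening_row A)" "delta n A = permmat n f"
    "0 \<le> cpar n A" "0 \<le> Echarge n A"
    "cpar n A + Echarge n A + 1 \<le> (\<Sum>i\<in>{opening_row A<..n}. of_bool (f (opening_row A) < f i))"
    by (rule Delta_range[OF A])
  obtain N where N: "N \<in> asm_set n 1" "is_positive N \<or> is_neutral N"
    and D: "Delta n N = (opening_row A, permmat n f, cpar n A + Echarge n A, 0)"
    using Delta_attained[OF f(1-4), of "cpar n A + Echarge n A" 0] f(6-8) by auto
  have E: "opening_row N = opening_row A" "delta n N = delta n A"
    "cpar n N = cpar n A + Echarge n A" "Echarge n N = 0"
    using D f(5) by (auto simp: Delta_def)
  have uniq: "M = N" if "M \<in> asm_set n 1 \<and> (is_positive M \<or> is_neutral M) \<and>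
    Delta n M = (opening_row A, delta n A, cpar n A + Echarge n A, 0)" for M
    using same_delta(4)[OF N, of M] that E by (auto simp: Delta_def)
  have the: "(THE N. N \<in> asm_set n 1 \<and> (is_positive N \<or> is_neutral N) \<and>
    Delta n N = (opening_row A, delta n A, cpar n A + Echarge n A, 0)) = N"
    by (rule the_equality[OF _ uniq]) (use N E in \<open>simp_all add: Delta_def\<close>)
  show thesis
  proof (rule that)
    show "Lam0 n A = (N, Echarge n A)" unfolding Lam0_def the ..
    show "is_neutral N" using asm_Echarge_eq_0[OF N] E(4) by simp
    show "ell n N = ell n A" using same_delta(1)[OF A N E(1,2)] .
    show "inversions n N = inversions n A" using same_delta(2)[OF A N E(1,2)] E by simp
    show "N i j = A i j" if "i \<le> opening_row A" for i j using same_delta(3)[OF A N E(1,2) that] .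
    show "N = A" if "is_neutral A"
      using same_delta(4)[OF A N E(1,2)] E asm_Echarge_eq_0[OF A] that by simp
    show "Echarge n A \<le> cpar n N" using E f by simp
  qed (use N E f in auto)
qed

text \<open>The image determines the opening row, \<open>delta\<close>, the charge, and
  \<open>cpar\<close> as that of \<open>N\<close> minus the charge: all of
  \<open>Delta\<close>.\<close>

lemma Lam0_inj:
  assumes A: "A \<in> asm_set n 1" "is_positive A \<or> is_neutral A"
    and B: "B \<in> asm_set n 1" "is_positive B \<or> is_neutral B"
    and eq: "Lam0 n A = Lam0 n B"
  shows "A = B"
proof -
  obtain N where N: "Lam0 n A = (N, Echarge n A)" "opening_row N = opening_row A"
    "delta n N = delta n A" "cpar n N = cpar n A + Echarge n A" by (rule Lam0_nonneg[OF A])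
  obtain M where M: "Lam0 n B = (M, Echarge n B)" "opening_row M = opening_row B"
    "delta n M = delta n B" "cpar n M = cpar n B + Echarge n B" by (rule Lam0_nonneg[OF B])
  have "M = N" "Echarge n A = Echarge n B" using N(1) M(1) eq by auto
  then show ?thesis using same_delta(4)[OF B A] N M by simp
qed

text \<open>The preimage keeps the opening row and \<open>delta\<close> of \<open>N\<close>, with
  \<open>cpar n N - E\<close> and charge \<open>E\<close>.\<close>

lemma Lam0_surj:
  assumes N: "N \<in> asm_set n 1" "is_neutral N" and E: "0 \<le> E" "E \<le> cpar n N"
  obtains A where "A \<in> asm_set n 1" "is_positive A \<or> is_neutral A" "Lam0 n A = (N, E)"
proof -
  have N': "is_positive N \<or> is_neutral N" using N by simp
  have E0: "Echarge n N = 0" using asm_Echarge_eq_0[OF N(1) N'] N(2) by simp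
  obtain f where f: "bij_betw f {1..n} {1..n}" "1 \<le> opening_row N" "opening_row N < n"
    "f (Suc (opening_row N)) < f (opening_row N)" "delta n N = permmat n f"
    "cpar n N + Echarge n N + 1 \<le> (\<Sum>i\<in>{opening_row N<..n}. of_bool (f (opening_row N) < f i))"
    by (rule Delta_range[OF N(1) N'])
  obtain A where A: "A \<in> asm_set n 1" "is_positive A \<or> is_neutral A"
    and D: "Delta n A = (opening_row N, permmat n f, cpar n N - E, E)"
    using Delta_attained[OF f(1-4), of "cpar n N - E" E] f(6) E E0 by auto
  have DA: "opening_row A = opening_row N" "delta n A = delta n N" "cpar n A + Echarge n A = cpar n N"
    "Echarge n A = E"
    using D f(5) by (auto simp: Delta_def)
  obtain M where M: "Lam0 n A = (M, Echarge n A)" "M \<in> asm_set n 1" "is_neutral M"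
    "opening_row M = opening_row A" "delta n M = delta n A" "cpar n M = cpar n A + Echarge n A"
    by (rule Lam0_nonneg[OF A])
  have "Echarge n M = 0" using asm_Echarge_eq_0[OF M(2)] M(3) by simp
  then have "M = N" using same_delta(4)[OF N(1) N' M(2)] M DA E0 by simp
  then show thesis using that A M(1) DA(4) by simp
qed

text \<open>Outside the neutral case this unfolds the definition, reflection being an involution. A
  neutral matrix and its reflection are both their own images, with charge 0.\<close>

lemma Lambda_reflect:
  assumes A: "A \<in> asm_set n 1" and L: "Lambda n A = (N, E)"
  shows "Lambda n (reflect n A) = (reflect n N, - E)"
proof -
  note R = asm_reflect[OF A] asm_reflect_reflect[OF A] asm_reflect_neutral[OF A]
    asm_reflect_positive[OF A] asm_reflect_negative[OF A] asm_not_negative[OF A]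
    asm_not_negative[OF asm_reflect[OF A]]
  consider "is_negative A" | "is_neutral A" "\<not> is_negative A" | "is_positive A" "\<not> is_negative A"
    using R by blast
  then show ?thesis
  proof cases
    case 1
    then have pos: "is_positive (reflect n A) \<or> is_neutral (reflect n A)" using R by blast
    obtain M where M: "Lam0 n (reflect n A) = (M, Echarge n (reflect n A))" "M \<in> asm_set n 1"
      by (rule Lam0_nonneg[OF R(1) pos])
    have "Lambda n A = (reflect n M, - Echarge n (reflect n A))"
      using 1 M(1) by (simp add: Lambda_def)
    moreover have "Lambda n (reflect n A) = (M, Echarge n (reflect n A))"
      using pos R M(1) by (simp add: Lambda_def)
    ultimately show ?thesis using L asm_reflect_reflect[OF M(2)] by auto
  next
    case 2
    then have n: "is_neutral (reflect n A)" "\<not> is_negative (reflect n A)" using R by auto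
    have self: "Lambda n B = (B, 0)" if B: "B \<in> asm_set n 1" "is_neutral B" "\<not> is_negative B" for B
    proof -
      have B': "is_positive B \<or> is_neutral B" using B by simp
      obtain M where "Lam0 n B = (M, Echarge n B)" "is_neutral B \<Longrightarrow> M = B"
        by (rule Lam0_nonneg[OF B(1) B']) blast
      then show ?thesis using B asm_Echarge_eq_0[OF B(1) B'] by (simp add: Lambda_def)
    qed
    show ?thesis using self[OF A 2] self[OF R(1) n] L by simp
  next
    case 3
    then have neg: "is_negative (reflect n A)" using R by blast
    have "Lambda n (reflect n A) = (case Lam0 n A of (M, E) \<Rightarrow> (reflect n M, - E))"
      using neg R(2) by (simp add: Lambda_def)
    moreover have "Lam0 n A = (N, E)" using L 3 by (simp add: Lambda_def)
    ultimately show ?thesis by simp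
  qed
qed

section \<open>Invariants of the neutralized matrix\<close>

lemma r_par_cong: "(\<And>j. A 1 j = B 1 j) \<Longrightarrow> r_par A = r_par B"
  by (simp add: r_par_def)

lemma Lambda_nonneg_conclusion:
  assumes A: "A \<in> asm_set n 1" "is_positive A \<or> is_neutral A" and L: "Lambda n A = (N, E)"
  shows "(N, E) \<in> Nset n" "0 \<le> E" "is_neutral A \<longleftrightarrow> N = A"
    "opening_row N = opening_row A" "\<And>i j. i \<le> opening_row A \<Longrightarrow> N i j = A i j"
    "inversions n N = inversions n A" "E = Echarge n A"
    "cpar n N = cpar n A + E" "ell n N = ell n A"
proof -
  have nn: "\<not> is_negative A" using asm_not_negative[OF A(1)] A(2) by simp
  obtain M where M: "Lam0 n A = (M, Echarge n A)" "M \<in> asm_set n 1" "is_neutral M"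
    "opening_row M = opening_row A" "cpar n M = cpar n A + Echarge n A"
    "0 \<le> Echarge n A" "Echarge n A \<le> cpar n M" "ell n M = ell n A"
    "inversions n M = inversions n A" "\<And>i j. i \<le> opening_row A \<Longrightarrow> M i j = A i j"
    "is_neutral A \<Longrightarrow> M = A"
    by (rule Lam0_nonneg[OF A]) blast
  have eq: "N = M" "E = Echarge n A" using L M(1) nn by (auto simp: Lambda_def)
  show "(N, E) \<in> Nset n" unfolding Nset_def eq using M asm_ell_nonneg[OF M(2)] by auto
  show "is_neutral A \<longleftrightarrow> N = A" using M(3,11) eq by auto
  show "0 \<le> E" "opening_row N = opening_row A" "inversions n N = inversions n A" "E = Echarge n A"
    "cpar n N = cpar n A + E" "ell n N = ell n A"
    using M(4-9) eq by simp_all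
  show "N i j = A i j" if "i \<le> opening_row A" for i j using M(10)[OF that] eq by simp
qed

lemma Bpar_Jpar_neutral:
  assumes "is_neutral N"
  shows "Bpar n N = cpar n N - ell n N" "Jpar n N = cpar n N + ell n N + 1"
  using assms by (simp_all add: is_negative_def is_positive_def Echarge_def Bpar_def Jpar_def)

text \<open>The negative case follows from the positive one by reflecting. The sign of
  \<open>E\<close> is recorded because it tells the two branches of \<open>Lambda\<close>
  apart.\<close>

lemma Lambda_conclusion:
  assumes A: "A \<in> asm_set n 1" and L: "Lambda n A = (N, E)"
  shows "(N, E) \<in> Nset n" "0 \<le> E \<longleftrightarrow> \<not> is_negative A" "is_neutral A \<longleftrightarrow> N = A"
    "opening_row N = opening_row A" "\<And>i j. i \<le> opening_row A \<Longrightarrow> N i j = A i j"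
    "inversions n N = inversions n A" "E = Echarge n A"
    "Bpar n N = Bpar n A + E" "Jpar n N = Jpar n A"
proof -
  have "(N, E) \<in> Nset n \<and> (0 \<le> E \<longleftrightarrow> \<not> is_negative A) \<and> (is_neutral A \<longleftrightarrow> N = A) \<and>
    opening_row N = opening_row A \<and> (\<forall>i j. i \<le> opening_row A \<longrightarrow> N i j = A i j) \<and>
    inversions n N = inversions n A \<and> E = Echarge n A \<and>
    Bpar n N = Bpar n A + E \<and> Jpar n N = Jpar n A"
  proof (cases "is_negative A")
    case False
    then have A': "is_positive A \<or> is_neutral A" using asm_not_negative[OF A] by simp
    note C = Lambda_nonneg_conclusion[OF A A' L]
    have N: "is_neutral N" using C(1) by (simp add: Nset_def)
    have "Bpar n N = Bpar n A + E" "Jpar n N = Jpar n A"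
      unfolding Bpar_Jpar_neutral[OF N] using False C(2,7,8,9) by (simp_all add: Bpar_def Jpar_def)
    then show ?thesis using C False by blast
  next
    case True
    let ?R = "reflect n A"
    have R: "?R \<in> asm_set n 1" "is_positive ?R \<or> is_neutral ?R" and pos: "is_positive ?R"
      using asm_reflect[OF A] asm_reflect_positive[OF A] True by auto
    obtain M E' where LR: "Lambda n ?R = (M, E')" by fastforce
    note C = Lambda_nonneg_conclusion[OF R LR]
    have M: "M \<in> asm_set n 1" "is_neutral M" "E' \<le> cpar n M" using C(1) by (auto simp: Nset_def)
    have NE: "N = reflect n M" "E = - E'"
      using Lambda_reflect[OF R(1) LR] L asm_reflect_reflect[OF A] by auto
    have N: "N \<in> asm_set n 1" "is_neutral N" "reflect n N = M"
      unfolding NE using asm_reflect[OF M(1)] asm_reflect_neutral[OF M(1)] asm_reflect_reflect[OF M(1)] M(2)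
      by auto
    have nA: "\<not> is_neutral A" "\<not> is_positive A" using True by (auto simp: is_negative_def is_positive_def)
    \<comment> \<open>Reflection exchanges \<open>ell\<close> and \<open>cpar\<close> of neutral
      matrices. Hence the upper bound on \<open>E'\<close> becomes the lower bound on
      \<open>E\<close>, \<open>Bpar\<close> changes sign and \<open>Jpar\<close> is
      preserved.\<close>
    have ell: "ell n N = cpar n M" "cpar n N = ell n M"
      using asm_neutral_ell[OF N(1,2)] asm_neutral_ell[OF M(1,2)] N(3) NE(1) by auto
    have nR: "\<not> is_neutral ?R" using pos by (simp add: is_positive_def)
    \<comment> \<open>A matrix that is not neutral has nonzero charge, so a negative
      \<open>A\<close> has \<open>E < 0\<close> strictly.\<close>
    then have "E' \<noteq> 0" using C(7) asm_Echarge_eq_0[OF R] by simp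
    then have E'0: "0 < E'" using C(2) by simp
    have "(N, E) \<in> Nset n" using N M ell C(2) asm_cpar_nonneg[OF N(1)] NE by (simp add: Nset_def)
    moreover have "N \<noteq> A" using N nA by blast
    moreover have row: "opening_row N = opening_row A"
      unfolding NE asm_reflect_row[OF M(1)] C(4) by (rule asm_reflect_row[OF A])
    moreover have "N i j = A i j" if "i \<le> opening_row A" for i j
    proof -
      have "M i j' = ?R i j'" for j' using C(5)[of i j'] that asm_reflect_row[OF A] by simp
      then have "reflect n M i j = reflect n ?R i j" by (simp add: reflect_def)
      then show ?thesis unfolding NE using asm_reflect_reflect[OF A] by simp
    qed
    moreover have "inversions n N = inversions n A"
      using asm_inversions_reflect[OF M(1)] asm_inversions_reflect[OF A] C(6) NE by simp
    moreover have EA: "E = Echarge n A"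
      using C(7) NE pos nA by (simp add: Echarge_def)
    moreover have "Bpar n N = Bpar n A + E" "Jpar n N = Jpar n A"
      unfolding Bpar_Jpar_neutral[OF N(2)] ell
      using True C(2,7,8,9) NE by (simp_all add: Bpar_def Jpar_def)
    ultimately show ?thesis using True nA E'0 NE by auto
  qed
  then show "(N, E) \<in> Nset n" "0 \<le> E \<longleftrightarrow> \<not> is_negative A" "is_neutral A \<longleftrightarrow> N = A"
    "opening_row N = opening_row A" "\<And>i j. i \<le> opening_row A \<Longrightarrow> N i j = A i j"
    "inversions n N = inversions n A" "E = Echarge n A"
    "Bpar n N = Bpar n A + E" "Jpar n N = Jpar n A"
    by blast+
qed

section \<open>Bijectivity\<close>

lemma Lambda_inj: "inj_on (Lambda n) (asm_set n 1)"
proof (rule inj_onI)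
  fix A B assume A: "A \<in> asm_set n 1" and B: "B \<in> asm_set n 1" and eq: "Lambda n A = Lambda n B"
  obtain N E where L: "Lambda n A = (N, E)" "Lambda n B = (N, E)" using eq by fastforce
  \<comment> \<open>The charge is part of the image and its sign reveals negativity, so either both
    matrices or both reflections fall under \<open>Lam0\<close>.\<close>
  have same: "is_negative A \<longleftrightarrow> is_negative B"
    using Lambda_conclusion(2)[OF A L(1)] Lambda_conclusion(2)[OF B L(2)] by blast
  have inj: "A = B" if A: "A \<in> asm_set n 1" "\<not> is_negative A" and B: "B \<in> asm_set n 1" "\<not> is_negative B"
    and eq: "Lambda n A = Lambda n B" for A B
    using Lam0_inj A B eq asm_not_negative by (metis Lambda_def)
  show "A = B"
  proof (cases "is_negative A")
    case False
    then show ?thesis using inj A B eq same by blast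
  next
    case True
    have "\<not> is_negative (reflect n A)" "\<not> is_negative (reflect n B)"
      using True same asm_reflect_negative A B by (auto simp: is_negative_def is_positive_def)
    moreover have "Lambda n (reflect n A) = Lambda n (reflect n B)"
      using Lambda_reflect[OF A L(1)] Lambda_reflect[OF B L(2)] by simp
    ultimately have "reflect n A = reflect n B" using inj asm_reflect A B by blast
    then show ?thesis using asm_reflect_reflect A B by metis
  qed
qed

lemma Lambda_image: "Lambda n ` asm_set n 1 = Nset n"
proof
  show "Lambda n ` asm_set n 1 \<subseteq> Nset n"
    using Lambda_conclusion(1) by (metis image_subsetI surj_pair)
  show "Nset n \<subseteq> Lambda n ` asm_set n 1"
  proof (clarify)
    fix N E assume "(N, E) \<in> Nset n"
    then have N: "N \<in> asm_set n 1" "is_neutral N" "- ell n N \<le> E" "E \<le> cpar n N" by (auto simp: Nset_def)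
    have surj: "\<exists>A\<in>asm_set n 1. Lambda n A = (N, E)"
      if "N \<in> asm_set n 1" "is_neutral N" "0 \<le> E" "E \<le> cpar n N" for N E
      using Lam0_surj[OF that] asm_not_negative by (metis Lambda_def)
    show "(N, E) \<in> Lambda n ` asm_set n 1"
    proof (cases "0 \<le> E")
      case True
      then show ?thesis using surj N by force
    next
      case False
      \<comment> \<open>For negative \<open>E\<close> the lower bound by \<open>ell\<close> becomes
        an upper bound by \<open>cpar\<close> after reflection.\<close>
      have "reflect n N \<in> asm_set n 1" "is_neutral (reflect n N)" "- E \<le> cpar n (reflect n N)"
        using asm_reflect[OF N(1)] asm_reflect_neutral[OF N(1)] asm_neutral_ell[OF N(1)] N by auto
      then obtain A where A: "A \<in> asm_set n 1" "Lambda n A = (reflect n N, - E)"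
        using surj[of "reflect n N" "- E"] False by auto
      have "Lambda n (reflect n A) = (N, E)"
        using Lambda_reflect[OF A] asm_reflect_reflect[OF N(1)] by simp
      then show ?thesis using asm_reflect[OF A(1)] by force
    qed
  qed
qed

theorem theorem1:
  fixes n :: nat
  shows "bij_betw (Lambda n) (asm_set n 1) (Nset n) \<and>
    (\<forall>A \<in> asm_set n 1. \<forall>N E. Lambda n A = (N, E) \<longrightarrow>
       (is_neutral A \<longleftrightarrow> N = A) \<and>
       Lambda n (reflect n A) = (reflect n N, - E) \<and>
       (opening_row N = opening_row A \<and>
        (\<forall>i j. 1 \<le> i \<and> i \<le> opening_row A \<longrightarrow> N i j = A i j) \<and>
        r_par N = r_par A) \<and>
       (inversions n N = inversions n A \<and> E = Echarge n A \<and>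
        Bpar n N = Bpar n A + Echarge n A \<and> Jpar n N = Jpar n A))"
proof (intro conjI ballI allI impI)
  show "bij_betw (Lambda n) (asm_set n 1) (Nset n)"
    by (simp only: bij_betw_def Lambda_inj Lambda_image simp_thms)
next
  fix A N E assume A: "A \<in> asm_set n 1" and L: "Lambda n A = (N, E)"
  note C = Lambda_conclusion[OF A L]
  show "is_neutral A \<longleftrightarrow> N = A" "opening_row N = opening_row A"
    "inversions n N = inversions n A" "E = Echarge n A" "Jpar n N = Jpar n A"
    by (rule C)+
  show "Lambda n (reflect n A) = (reflect n N, - E)" by (rule Lambda_reflect[OF A L])
  show "N i j = A i j" if "1 \<le> i \<and> i \<le> opening_row A" for i j using C(5) that by blast
  \<comment> \<open>The opening row has index at least 1, so row 1 is among the unchanged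
    rows.\<close>
  show "r_par N = r_par A" using C(5)[OF asm_row_1[OF A]] by (rule r_par_cong)
  show "Bpar n N = Bpar n A + Echarge n A" using C(7,8) by simp
qed

end
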